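(* Let $(G,T,\mathcal{K})$ be a K-network in which $\mathcal{K}$ is simple. Then $$\max_f \Theta(f)=\min_{\mathcal{X}}\Big(\tfrac12\sum_{t\in T} d(X_t)-\tfrac12\sum_{A\in\mathcal{K}_{\mathcal{X}}}\beta_{\mathcal{X}}(A)\Big),$$ where the maximum is over all fractional multiflows in $(G,T)$ and the minimum is over all expansions $\mathcal{X}=(X_t)_{t\in T}$. Moreover, the expression on the right-hand side equals $\max_f\Theta(f)$ for every dual solution $\mathcal{X}$.
   Context: $G=(N,E)$ finite undirected multigraph, $T\subseteq N$ terminals, $N\setminus T$ inner nodes; demand graph $(T,S)$ with $S$ a set of unordered terminal pairs; $\mathcal{K}$ the set of inclusion-maximal stable sets (anticliques) of $(T,S)$. K-network: every inner node has even degree and any three distinct pairwise intersecting anticliques $A,B,C$ satisfy $A\cap B=A\cap C=B\cap C$. $\mathcal{K}$ is simple if for any two distinct terminals some member of $\mathcal{K}$ contains exactly one of them. A $T$-path is an unclosed path with ends in $T$; a fractional multiflow is a nonnegative weighting of $T$-paths with total weight through each adjacent pair $x,y$ (counted with multiplicity of traversed $(x,y)$-edges) at most the number of $(x,y)$-edges. $f[u,v]$ = total weight of paths with end-pair $\{u,v\}$, $|f|$ = total weight. $\omega(u,v)=1$ if $\{u,v\}\in S$, $\tfrac12$ if $\{u,v\}$ lies in exactly one anticlique, $0$ if in at least two; $\Theta(f)=\sum\omega(u,v)f[u,v]$, $\theta=\max_f\Theta(f)$. For $X\subseteq N$, $d(X)$ is the number of edges between $X$ and $N\setminus X$. An expansion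 is a family $\mathcal{X}=(X_t)_{t\in T}$ of pairwise disjoint subsets of $N$ with $X_t\cap T=\{t\}$. $G_{\mathcal{X}}$ is obtained by contracting each $X_t$ to a single terminal (also called $X_t$); the terminal set is $\mathcal{X}$, the pair $(X_s,X_t)$ inherits $\omega(s,t)$, and $\mathcal{K}_{\mathcal{X}}=\{\{X_t:t\in A\}:A\in\mathcal{K}\}$. In $G_{\mathcal{X}}$, for a set $B$ of terminals, $\lambda_{\mathcal{X}}(B)=\min\{d(Z): Z\text{ node set of }G_{\mathcal{X}},\ Z\cap\mathcal{X}=B\}$ and $\beta_{\mathcal{X}}(B)=\tfrac12\big(\sum_{Y\in B}\lambda_{\mathcal{X}}(\{Y\})-\lambda_{\mathcal{X}}(B)\big)$. An $\mathcal{X}$-flow is a fractional multiflow in $G_{\mathcal{X}}$ with terminal set $\mathcal{X}$; $\Theta_{\mathcal{X}}$ and $\theta_{\mathcal{X}}$ are defined as $\Theta,\theta$ there. Partial order: $\mathcal{X}\preceq\mathcal{Y}$ if every $X_t\subseteq Y_t$. $\mathcal{X}$ is critical if $\theta_{\mathcal{Y}}>\theta_{\mathcal{X}}$ for every $\mathcal{Y}\succeq\mathcal{X}$ with $\mathcal{Y}\neq\mathcal{X}$; a dual solution is a critical expansion with $\theta_{\mathcal{X}}=\theta$. *)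

theory Defs
  imports Complex_Main "HOL-Library.Disjoint_Sets"
begin

text \<open>
  The edges of a multigraph carry identities; \<open>ends G e\<close> is the set of end nodes of \<open>e\<close>,
  a singleton if \<open>e\<close> is a loop.
\<close>

record ('v, 'e) network =
  nodes :: "'v set"
  edges :: "'e set"
  ends :: "'e \<Rightarrow> 'v set"
  terminals :: "'v set"
  demands :: "'v set set"

definition wf_network :: "('v, 'e) network \<Rightarrow> bool" where
  "wf_network G \<longleftrightarrow>
     finite (nodes G) \<and> finite (edges G) \<and>
     (\<forall>e\<in>edges G. ends G e \<subseteq> nodes G \<and> card (ends G e) \<in> {1, 2}) \<and>
     terminals G \<subseteq> nodes G \<and>
     (\<forall>p\<in>demands G. p \<subseteq> terminals G \<and> card p = 2)"

definition stable :: "('v, 'e) network \<Rightarrow> 'v set \<Rightarrow> bool" where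
  "stable G A \<longleftrightarrow> A \<subseteq> terminals G \<and> (\<forall>u\<in>A. \<forall>v\<in>A. {u, v} \<notin> demands G)"

definition anticliques :: "('v, 'e) network \<Rightarrow> 'v set set" where
  "anticliques G = {A. stable G A \<and> (\<forall>B. stable G B \<and> A \<subseteq> B \<longrightarrow> B = A)}"

text \<open>A loop contributes 2 to the degree of its node.\<close>

definition degree :: "('v, 'e) network \<Rightarrow> 'v \<Rightarrow> nat" where
  "degree G v = card {e \<in> edges G. v \<in> ends G e} + card {e \<in> edges G. ends G e = {v}}"

definition K_network :: "('v, 'e) network \<Rightarrow> bool" where
  "K_network G \<longleftrightarrow>
     wf_network G \<and>
     (\<forall>v \<in> nodes G - terminals G. even (degree G v)) \<and>
     (\<forall>A\<in>anticliques G. \<forall>B\<in>anticliques G. \<forall>C\<in>anticliques G.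
        A \<noteq> B \<and> A \<noteq> C \<and> B \<noteq> C \<and> A \<inter> B \<noteq> {} \<and> A \<inter> C \<noteq> {} \<and> B \<inter> C \<noteq> {} \<longrightarrow>
        A \<inter> B = A \<inter> C \<and> A \<inter> C = B \<inter> C)"

definition simple_anticliques :: "('v, 'e) network \<Rightarrow> bool" where
  "simple_anticliques G \<longleftrightarrow>
     (\<forall>s\<in>terminals G. \<forall>t\<in>terminals G. s \<noteq> t \<longrightarrow>
        (\<exists>A\<in>anticliques G. (s \<in> A) \<noteq> (t \<in> A)))"

text \<open>
  A path is given by its node sequence and its edge sequence. Its edges are distinct, whereas
  nodes may be repeated, so a path may use several of the edges joining a given pair of nodes.
  A path and its reverse are distinct objects here; they have the same end-pair and traverse the
  same edges, so only the sum of their weights matters.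
\<close>

definition T_paths :: "('v, 'e) network \<Rightarrow> ('v list \<times> 'e list) set" where
  "T_paths G = {(vs, es).
     set vs \<subseteq> nodes G \<and> set es \<subseteq> edges G \<and> distinct es \<and>
     length vs = Suc (length es) \<and>
     (\<forall>i < length es. ends G (es ! i) = {vs ! i, vs ! Suc i}) \<and>
     hd vs \<in> terminals G \<and> last vs \<in> terminals G \<and> hd vs \<noteq> last vs}"

definition end_pair :: "'v list \<times> 'e list \<Rightarrow> 'v set" where
  "end_pair p = {hd (fst p), last (fst p)}"

definition traversals ::
    "('v, 'e) network \<Rightarrow> 'v list \<times> 'e list \<Rightarrow> 'v \<Rightarrow> 'v \<Rightarrow> nat" where
  "traversals G p x y = length (filter (\<lambda>e. ends G e = {x, y}) (snd p))"

text \<open>In a well-formed network the set of T-paths is finite, so the sums below are finite.\<close>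

definition multiflow :: "('v, 'e) network \<Rightarrow> ('v list \<times> 'e list \<Rightarrow> real) \<Rightarrow> bool" where
  "multiflow G f \<longleftrightarrow>
     (\<forall>p\<in>T_paths G. 0 \<le> f p) \<and>
     (\<forall>x\<in>nodes G. \<forall>y\<in>nodes G.
        (\<Sum>p\<in>T_paths G. real (traversals G p x y) * f p)
          \<le> real (card {e \<in> edges G. ends G e = {x, y}}))"

definition flow_between ::
    "('v, 'e) network \<Rightarrow> ('v list \<times> 'e list \<Rightarrow> real) \<Rightarrow> 'v set \<Rightarrow> real" where
  "flow_between G f q = (\<Sum>p \<in> {p \<in> T_paths G. end_pair p = q}. f p)"

definition omega :: "('v, 'e) network \<Rightarrow> 'v set \<Rightarrow> real" where
  "omega G q =
     (if q \<in> demands G then 1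
      else if card {A \<in> anticliques G. q \<subseteq> A} = 1 then 1 / 2
      else 0)"

definition Theta :: "('v, 'e) network \<Rightarrow> ('v list \<times> 'e list \<Rightarrow> real) \<Rightarrow> real" where
  "Theta G f = (\<Sum>q \<in> {q. q \<subseteq> terminals G \<and> card q = 2}. omega G q * flow_between G f q)"

text \<open>
  The multiflows restricted to the T-paths form a nonempty compact polytope, so this supremum
  is a maximum.
\<close>

definition theta :: "('v, 'e) network \<Rightarrow> real" where
  "theta G = (SUP f \<in> {f. multiflow G f}. Theta G f)"

definition cut :: "('v, 'e) network \<Rightarrow> 'v set \<Rightarrow> nat" where
  "cut G X = card {e \<in> edges G. ends G e \<inter> X \<noteq> {} \<and> ends G e \<inter> (nodes G - X) \<noteq> {}}"

definition lambda :: "('v, 'e) network \<Rightarrow> 'v set \<Rightarrow> nat" where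
  "lambda G B = Min {cut G Z | Z. Z \<subseteq> nodes G \<and> Z \<inter> terminals G = B}"

definition beta :: "('v, 'e) network \<Rightarrow> 'v set \<Rightarrow> real" where
  "beta G B = ((\<Sum>t\<in>B. real (lambda G {t})) - real (lambda G B)) / 2"

text \<open>
  A family indexed by the terminals is a function whose values outside \<open>terminals G\<close> are irrelevant.
\<close>

definition expansion :: "('v, 'e) network \<Rightarrow> ('v \<Rightarrow> 'v set) \<Rightarrow> bool" where
  "expansion G X \<longleftrightarrow>
     (\<forall>t\<in>terminals G. X t \<subseteq> nodes G \<and> X t \<inter> terminals G = {t}) \<and>
     disjoint_family_on X (terminals G)"

text \<open>
  The node obtained by contracting \<open>X t\<close> is named \<open>t\<close>. Under this naming the contracted network
  has the same terminals, the same demand pairs, hence the same anticliques and weights \<open>omega\<close>.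
  Edges inside some \<open>X t\<close> become loops, which affect neither cuts nor the value of a multiflow.
\<close>

definition contraction_map :: "('v, 'e) network \<Rightarrow> ('v \<Rightarrow> 'v set) \<Rightarrow> 'v \<Rightarrow> 'v" where
  "contraction_map G X v =
     (if \<exists>t\<in>terminals G. v \<in> X t then THE t. t \<in> terminals G \<and> v \<in> X t else v)"

definition contract :: "('v, 'e) network \<Rightarrow> ('v \<Rightarrow> 'v set) \<Rightarrow> ('v, 'e) network" where
  "contract G X =
     G\<lparr>nodes := contraction_map G X ` nodes G,
       ends := (\<lambda>e. contraction_map G X ` ends G e)\<rparr>"

definition expansion_le ::
    "('v, 'e) network \<Rightarrow> ('v \<Rightarrow> 'v set) \<Rightarrow> ('v \<Rightarrow> 'v set) \<Rightarrow> bool" where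
  "expansion_le G X Y \<longleftrightarrow> (\<forall>t\<in>terminals G. X t \<subseteq> Y t)"

definition critical :: "('v, 'e) network \<Rightarrow> ('v \<Rightarrow> 'v set) \<Rightarrow> bool" where
  "critical G X \<longleftrightarrow>
     expansion G X \<and>
     (\<forall>Y. expansion G Y \<and> expansion_le G X Y \<and> (\<exists>t\<in>terminals G. Y t \<noteq> X t) \<longrightarrow>
        theta (contract G Y) > theta (contract G X))"

definition dual_solution :: "('v, 'e) network \<Rightarrow> ('v \<Rightarrow> 'v set) \<Rightarrow> bool" where
  "dual_solution G X \<longleftrightarrow> critical G X \<and> theta (contract G X) = theta G"

definition dual_value :: "('v, 'e) network \<Rightarrow> ('v \<Rightarrow> 'v set) \<Rightarrow> real" where
  "dual_value G X =
     (\<Sum>t\<in>terminals G. real (cut G (X t))) / 2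
     - (\<Sum>A\<in>anticliques (contract G X). beta (contract G X) A) / 2"

end

theory Submission
  imports Defs "HOL-Analysis.Analysis"
begin

text \<open>
  Linear programming duality turns the maximum of \<open>Theta\<close> into a minimum over edge lengths for which
  any two terminals have distance at least \<open>omega\<close>. For a simple K-network two terminals lie in at
  most one common anticlique, and the tight span of \<open>omega\<close> is a two-dimensional complex glued from
  triangles with corners \<open>At t\<close>, \<open>Mid A\<close>, \<open>Centre\<close> for terminals \<open>t\<close> of anticliques \<open>A\<close>. Retracting the nodes to
  the tight span and rounding all of them to corners with one random threshold does not increase
  expected distances. Hence the maximum equals the minimum cost of a labelling of the nodes by
  corners, and a labelling of a contracted network pulls back to the network itself.

  Minimum cuts of the anticliques in a contracted network yield a labelling: nodes in no cut go to
  \<open>Centre\<close>, nodes in one cut to \<open>Mid A\<close>, and nodes in several cuts to the terminal that these anticliques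
  share. So the cut expression is an upper bound for every expansion. Conversely, in a network
  contracted along a critical expansion an optimal labelling sends no other node to a terminal, and
  its cost then is at least the cut expression.
\<close>

section \<open>Linear programming duality\<close>

text \<open>Rounding loses nothing because the sup norm is an l1 norm inside a triangle. In
  coordinates \<open>u\<close>, \<open>w\<close> between 0 and 1/4 a tight function has the value
  \<open>u + w\<close> at \<open>t\<close> and \<open>1 / 2 - u + w\<close> on the rest of
  \<open>A\<close>. The larger of the two changes is the sum of the absolute changes of
  \<open>u\<close> and \<open>w\<close>, and a uniform threshold in [0,1/4] separates two values of
  a coordinate with measure equal to their difference.

  Both cut estimates rest on one count. Give \<open>At t\<close>, \<open>Mid A\<close>,
  \<open>Centre\<close> the ranks 2, 1, 0. Unless both labels are the same terminal,
  \<open>qdist\<close> is the sum of the ranks, minus 2 if the labels belong to a common anticlique.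
  The symmetric difference of two families of cuts is counted in the same way. The obstacle is a
  terminal in \<open>m\<close> anticliques: it lies in \<open>m\<close> of their cuts while its rank
  is 2. The coefficient \<open>2 - m\<close> of its own cut has to balance this. That is exact if no
  other node is labelled by the terminal, which is what criticality provides.\<close>

inductive_set row_cone :: "(('v \<Rightarrow> real) \<times> real) set \<Rightarrow> (('v \<Rightarrow> real) \<times> real) set"
  for S where
    zero: "(\<lambda>_. 0, 0) \<in> row_cone S"
  | base: "s \<in> S \<Longrightarrow> 0 \<le> c \<Longrightarrow> (\<lambda>z. c * fst s z, c * snd s) \<in> row_cone S"
  | add: "r \<in> row_cone S \<Longrightarrow> s \<in> row_cone S \<Longrightarrow>
      (\<lambda>z. fst r z + fst s z, snd r + snd s) \<in> row_cone S"

lemma row_cone_scale: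
  assumes "s \<in> row_cone S" "0 \<le> c"
  shows "(\<lambda>z. c * fst s z, c * snd s) \<in> row_cone S"
  using assms(1)
proof induction
  case zero
  then show ?case using row_cone.zero by simp
next
  case (base s d)
  then show ?case using row_cone.base[of s S "c * d"] assms(2) by (simp add: mult.assoc)
next
  case (add r s)
  then show ?case using row_cone.add[OF add.IH] by (simp add: algebra_simps)
qed

lemma row_cone_subset:
  assumes "s \<in> row_cone S'" "S' \<subseteq> row_cone S"
  shows "s \<in> row_cone S"
  using assms(1)
proof induction
  case (base s c)
  then show ?case using row_cone_scale assms(2) by blast
qed (auto intro: row_cone.intros)

lemma row_cone_coeff_zero:
  assumes "s \<in> row_cone S" "\<And>r. r \<in> S \<Longrightarrow> fst r v = 0"
  shows "fst s v = 0"
  using assms(1) by induction (auto simp: assms(2))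

text \<open>Several indices may produce the same row. The multipliers are therefore attached to
  indices, and a base row puts its whole weight on one index that produces it.\<close>

lemma row_cone_image:
  assumes "s \<in> row_cone ((\<lambda>i. (a i, b i)) ` I)" "finite I"
  shows "\<exists>y. (\<forall>i\<in>I. 0 \<le> y i) \<and> fst s = (\<lambda>z. \<Sum>i\<in>I. y i * a i z) \<and> snd s = (\<Sum>i\<in>I. y i * b i)"
  using assms(1)
proof induction
  case zero
  show ?case by (rule exI[of _ "\<lambda>_. 0"]) simp
next
  case (base s c)
  then obtain i where i: "i \<in> I" "s = (a i, b i)" by auto
  have *: "(\<Sum>j\<in>I. (if j = i then c else 0) * g j) = c * g i" for g :: "_ \<Rightarrow> real"
    using sum.delta[OF assms(2), of i "\<lambda>j. c * g j"] i(1)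
    by (simp add: if_distrib[of "\<lambda>u. u * _"] cong: if_cong)
  show ?case
    by (rule exI[of _ "\<lambda>j. if j = i then c else 0"]) (use * i base in auto)
next
  case (add r s)
  then obtain y y' where "\<forall>i\<in>I. 0 \<le> y i" "fst r = (\<lambda>z. \<Sum>i\<in>I. y i * a i z)" "snd r = (\<Sum>i\<in>I. y i * b i)"
    "\<forall>i\<in>I. 0 \<le> y' i" "fst s = (\<lambda>z. \<Sum>i\<in>I. y' i * a i z)" "snd s = (\<Sum>i\<in>I. y' i * b i)"
    by blast
  then show ?case
    by (intro exI[of _ "\<lambda>i. y i + y' i"]) (simp add: sum.distrib algebra_simps)
qed

lemma exists_between_finite:
  fixes L U :: "real set"
  assumes "finite L" "finite U" "\<And>l u. l \<in> L \<Longrightarrow> u \<in> U \<Longrightarrow> l \<le> u"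
  shows "\<exists>x. (\<forall>l\<in>L. l \<le> x) \<and> (\<forall>u\<in>U. x \<le> u)"
proof (cases "L = {}")
  case True
  then show ?thesis
    by (cases "U = {}") (auto intro: exI[of _ "Min U"] simp: assms(2))
next
  case False
  then show ?thesis using assms by (intro exI[of _ "Max L"]) auto
qed

text \<open>Fourier--Motzkin elimination of one variable after the other.\<close>

lemma row_cone_farkas:
  assumes "finite V" "finite S"
    and "\<nexists>x. \<forall>s\<in>S. (\<Sum>v\<in>V. fst s v * x v) \<le> snd s"
  shows "\<exists>s\<in>row_cone S. (\<forall>v\<in>V. fst s v = 0) \<and> snd s < 0"
  using assms
proof (induction V arbitrary: S rule: finite_induct)
  case empty
  then obtain s where "s \<in> S" "snd s < 0" by force
  then show ?case using row_cone.base[of s S 1] by (auto intro!: bexI[of _ s])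
next
  case (insert v V)
  \<comment> \<open>For \<open>s\<close> in \<open>P\<close> and \<open>r\<close> in
    \<open>N\<close> both multipliers are positive, and the coefficients of \<open>v\<close>
    cancel.\<close>
  define comb where "comb s r =
    ((\<lambda>z. (- fst r v) * fst s z + fst s v * fst r z), (- fst r v) * snd s + fst s v * snd r)"
    for s r :: "('a \<Rightarrow> real) \<times> real"
  define P where "P = {s \<in> S. fst s v > 0}"
  define N where "N = {s \<in> S. fst s v < 0}"
  define S' where "S' = {s \<in> S. fst s v = 0} \<union> (\<lambda>(s, r). comb s r) ` (P \<times> N)"
  have fin: "finite P" "finite N" "finite S'"
    using insert.prems by (auto simp: P_def N_def S'_def)
  have sub: "S' \<subseteq> row_cone S"
  proof
    fix s assume "s \<in> S'"
    then consider "s \<in> S" | p n where "p \<in> P" "n \<in> N" "s = comb p n"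
      by (auto simp: S'_def)
    then show "s \<in> row_cone S"
    proof cases
      case 1
      then show ?thesis using row_cone.base[of s S 1] by simp
    next
      case 2
      then show ?thesis
        using row_cone.add[OF row_cone.base[of p S "- fst n v"] row_cone.base[of n S "fst p v"]]
        by (simp add: comb_def P_def N_def)
    qed
  qed
  have zero: "fst r v = 0" if "r \<in> S'" for r
    using that by (auto simp: S'_def comb_def)
  have "\<nexists>x. \<forall>s\<in>S'. (\<Sum>z\<in>V. fst s z * x z) \<le> snd s"
  proof
    assume "\<exists>x. \<forall>s\<in>S'. (\<Sum>z\<in>V. fst s z * x z) \<le> snd s"
    then obtain x where x: "\<And>s. s \<in> S' \<Longrightarrow> (\<Sum>z\<in>V. fst s z * x z) \<le> snd s" by blast
    \<comment> \<open>The bound that row \<open>s\<close> imposes on the value at \<open>v\<close>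
      once \<open>x\<close> is fixed: an upper bound for rows in \<open>P\<close>, a lower bound for
      rows in \<open>N\<close>, where dividing by the coefficient reverses the inequality.\<close>
    define B where "B s = (snd s - (\<Sum>z\<in>V. fst s z * x z)) / fst s v" for s
    have "B n \<le> B p" if "p \<in> P" "n \<in> N" for p n
    proof -
      have "comb p n \<in> S'" using that by (auto simp: S'_def)
      have "(\<Sum>z\<in>V. fst (comb p n) z * x z)
          = (- fst n v) * (\<Sum>z\<in>V. fst p z * x z) + fst p v * (\<Sum>z\<in>V. fst n z * x z)"
        unfolding sum_distrib_left sum.distrib[symmetric]
        by (intro sum.cong) (auto simp: comb_def algebra_simps)
      with x[OF \<open>comb p n \<in> S'\<close>]
      have "(- fst n v) * (\<Sum>z\<in>V. fst p z * x z) + fst p v * (\<Sum>z\<in>V. fst n z * x z)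
         \<le> (- fst n v) * snd p + fst p v * snd n"
        by (simp add: comb_def)
      moreover have "fst p v > 0" "fst n v < 0" using that by (auto simp: P_def N_def)
      ultimately show ?thesis by (simp add: B_def field_simps)
    qed
    then have "\<exists>c. (\<forall>l\<in>B ` N. l \<le> c) \<and> (\<forall>u\<in>B ` P. c \<le> u)"
      by (intro exists_between_finite) (use fin in blast)+
    then obtain c where c: "\<And>n. n \<in> N \<Longrightarrow> B n \<le> c" "\<And>p. p \<in> P \<Longrightarrow> c \<le> B p"
      by blast
    have "(\<Sum>z\<in>insert v V. fst s z * (x(v := c)) z) \<le> snd s" if "s \<in> S" for s
    proof -
      have *: "(\<Sum>z\<in>insert v V. fst s z * (x(v := c)) z) = fst s v * c + (\<Sum>z\<in>V. fst s z * x z)"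
        using insert.hyps by (simp cong: sum.cong) (intro sum.cong, auto)
      consider "fst s v = 0" | "s \<in> P" | "s \<in> N" using \<open>s \<in> S\<close> by (force simp: P_def N_def)
      then show ?thesis
      proof cases
        case 1
        then show ?thesis using x[of s] that * by (simp add: S'_def)
      next
        case 2
        then show ?thesis using c(2)[of s] * by (simp add: B_def P_def field_simps)
      next
        case 3
        then show ?thesis using c(1)[of s] * by (simp add: B_def N_def field_simps)
      qed
    qed
    then show False using insert.prems(2) by blast
  qed
  from insert.IH[OF fin(3) this] obtain s where
    s: "s \<in> row_cone S'" "\<forall>z\<in>V. fst s z = 0" "snd s < 0" by blast
  then show ?case
    using row_cone_subset[OF s(1) sub] row_cone_coeff_zero[OF s(1) zero] by blast
qed

lemma farkas:
  fixes a :: "'i \<Rightarrow> 'v \<Rightarrow> real"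
  assumes "finite I" "finite V" "\<nexists>x. \<forall>i\<in>I. (\<Sum>v\<in>V. a i v * x v) \<le> b i"
  shows "\<exists>y. (\<forall>i\<in>I. 0 \<le> y i) \<and> (\<forall>v\<in>V. (\<Sum>i\<in>I. y i * a i v) = 0) \<and> (\<Sum>i\<in>I. y i * b i) < 0"
proof -
  let ?S = "(\<lambda>i. (a i, b i)) ` I"
  have "\<exists>s\<in>row_cone ?S. (\<forall>v\<in>V. fst s v = 0) \<and> snd s < 0"
    by (rule row_cone_farkas) (use assms in auto)
  then obtain s where s: "s \<in> row_cone ?S" "\<forall>v\<in>V. fst s v = 0" "snd s < 0" by blast
  from row_cone_image[OF s(1) assms(1)] s(2,3) show ?thesis by auto
qed

text \<open>If \<open>M\<close> were out of reach, the objective row would contradict the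
  constraints. Farkas multipliers, scaled to weight 1 on the objective row, would be a dual solution
  of value below \<open>M\<close>. As all dual solutions are bounded by hypothesis, no dual optimum
  has to be attained.\<close>

lemma lp_duality:
  fixes a :: "'q \<Rightarrow> 'p \<Rightarrow> real"
  assumes fin: "finite Q" "finite P" and c: "\<And>q. q \<in> Q \<Longrightarrow> 0 \<le> c q"
    and dual: "\<And>l. (\<And>q. q \<in> Q \<Longrightarrow> 0 \<le> l q) \<Longrightarrow> (\<And>p. p \<in> P \<Longrightarrow> w p \<le> (\<Sum>q\<in>Q. l q * a q p)) \<Longrightarrow>
      M \<le> (\<Sum>q\<in>Q. l q * c q)"
  shows "\<exists>f. (\<forall>p\<in>P. 0 \<le> f p) \<and> (\<forall>q\<in>Q. (\<Sum>p\<in>P. a q p * f p) \<le> c q) \<and> M \<le> (\<Sum>p\<in>P. w p * f p)"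
proof (rule ccontr)
  assume no: "\<not> ?thesis"
  \<comment> \<open>\<open>None\<close> is the objective row, \<open>Inl q\<close> a capacity,
    \<open>Inr p'\<close> the nonnegativity of \<open>f p'\<close>.\<close>
  define I where "I = insert None (Some ` (Inl ` Q \<union> Inr ` P))"
  define A where "A i p = (case i of None \<Rightarrow> - w p | Some (Inl q) \<Rightarrow> a q p
      | Some (Inr p') \<Rightarrow> if p' = p then - 1 else 0)" for i p
  define b where "b i = (case i of None \<Rightarrow> - M | Some (Inl q) \<Rightarrow> c q | Some (Inr p') \<Rightarrow> 0)" for i :: "('q + 'p) option"
  have delta: "(\<Sum>p\<in>P. (if p' = p then - 1 else 0) * f p) = - f p'" if "p' \<in> P" for f :: "'p \<Rightarrow> real" and p'
    using sum.delta'[OF fin(2), of p' "\<lambda>p. - f p"] that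
    by (simp add: if_distrib[of "\<lambda>u. u * _"] cong: if_cong)
  have "\<nexists>f. \<forall>i\<in>I. (\<Sum>p\<in>P. A i p * f p) \<le> b i"
  proof
    assume "\<exists>f. \<forall>i\<in>I. (\<Sum>p\<in>P. A i p * f p) \<le> b i"
    then obtain f where "\<forall>i\<in>I. (\<Sum>p\<in>P. A i p * f p) \<le> b i" by blast
    then have f: "(\<Sum>p\<in>P. A i p * f p) \<le> b i" if "i \<in> I" for i
      using that by blast
    have "M \<le> (\<Sum>p\<in>P. w p * f p)"
      using f[of None] by (simp add: I_def A_def b_def sum_negf)
    moreover have "(\<Sum>p\<in>P. a q p * f p) \<le> c q" if "q \<in> Q" for q
      using f[of "Some (Inl q)"] that by (simp add: I_def A_def b_def)
    moreover have "0 \<le> f p" if "p \<in> P" for p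
      using f[of "Some (Inr p)"] that delta[OF that, of f] by (simp add: I_def A_def b_def)
    ultimately have "M \<le> (\<Sum>p\<in>P. w p * f p)" "\<forall>q\<in>Q. (\<Sum>p\<in>P. a q p * f p) \<le> c q"
      "\<forall>p\<in>P. 0 \<le> f p" by blast+
    with no show False by blast
  qed
  from farkas[OF _ fin(2) this] fin obtain y where
    y: "\<forall>i\<in>I. 0 \<le> y i" "\<forall>p\<in>P. (\<Sum>i\<in>I. y i * A i p) = 0" "(\<Sum>i\<in>I. y i * b i) < 0"
    by (auto simp: I_def)
  have split: "(\<Sum>i\<in>I. g i) = g None + (\<Sum>q\<in>Q. g (Some (Inl q))) + (\<Sum>p\<in>P. g (Some (Inr p)))"
    for g :: "('q + 'p) option \<Rightarrow> real"
  proof -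
    have "(\<Sum>i\<in>I. g i) = g None + (\<Sum>i\<in>Some ` (Inl ` Q) \<union> Some ` (Inr ` P). g i)"
      using fin by (simp add: I_def image_Un)
    also have "(\<Sum>i\<in>Some ` (Inl ` Q) \<union> Some ` (Inr ` P). g i)
        = (\<Sum>i\<in>Some ` (Inl ` Q). g i) + (\<Sum>i\<in>Some ` (Inr ` P). g i)"
      using fin by (intro sum.union_disjoint) auto
    finally show ?thesis by (simp add: sum.reindex inj_on_def)
  qed
  define \<mu> where "\<mu> = y None"
  define l where "l q = y (Some (Inl q))" for q
  have nn: "0 \<le> \<mu>" "\<And>q. q \<in> Q \<Longrightarrow> 0 \<le> l q" "\<And>p. p \<in> P \<Longrightarrow> 0 \<le> y (Some (Inr p))"
    using y(1) by (auto simp: I_def \<mu>_def l_def)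
  have col: "\<mu> * w p \<le> (\<Sum>q\<in>Q. l q * a q p)" if "p \<in> P" for p
  proof -
    have "(\<Sum>p'\<in>P. y (Some (Inr p')) * (if p' = p then - 1 else 0)) = - y (Some (Inr p))"
      using sum.delta[OF fin(2), of p "\<lambda>p. - y (Some (Inr p))"] that
      by (simp add: if_distrib[of "\<lambda>u. _ * u"] cong: if_cong)
    with bspec[OF y(2) that] nn(3)[OF that] show ?thesis
      by (simp add: split A_def \<mu>_def l_def)
  qed
  have val: "(\<Sum>q\<in>Q. l q * c q) < \<mu> * M"
    using y(3) by (simp add: split b_def \<mu>_def l_def)
  show False
  \<comment> \<open>With weight 0 on the objective row the capacities alone would have a negative
    combination, but \<open>c\<close> is nonnegative.\<close>
  proof (cases "\<mu> = 0")
    case True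
    have "0 \<le> (\<Sum>q\<in>Q. l q * c q)" by (intro sum_nonneg mult_nonneg_nonneg nn c)
    with True val show False by simp
  next
    case False
    then have pos: "\<mu> > 0" using nn(1) by simp
    have "M \<le> (\<Sum>q\<in>Q. l q / \<mu> * c q)"
    proof (rule dual)
      show "w p \<le> (\<Sum>q\<in>Q. l q / \<mu> * a q p)" if "p \<in> P" for p
        using col[OF that] pos by (simp add: sum_divide_distrib[symmetric] field_simps)
    qed (use nn pos in auto)
    then show False using val pos by (simp add: sum_divide_distrib[symmetric] field_simps)
  qed
qed

section \<open>Cuts and multiflows as edge sums\<close>

text \<open>Halving the sum over ordered pairs of ends avoids orienting the edge. For symmetric
  \<open>d\<close> with zero diagonal an edge contributes its \<open>d\<close>-length and a loop
  contributes 0.\<close>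

definition edge_total :: "('v, 'e) network \<Rightarrow> ('v \<Rightarrow> 'v \<Rightarrow> real) \<Rightarrow> real" where
  "edge_total G d = (\<Sum>e\<in>edges G. (\<Sum>x\<in>ends G e. \<Sum>y\<in>ends G e. d x y) / 2)"

lemma wf_network_ends:
  assumes "wf_network G" "e \<in> edges G"
  obtains x y where "x \<in> nodes G" "y \<in> nodes G" "ends G e = {x, y}"
proof -
  have *: "ends G e \<subseteq> nodes G" "card (ends G e) \<in> {1, 2}"
    using assms by (auto simp: wf_network_def)
  then consider x where "ends G e = {x}" | x y where "ends G e = {x, y}"
    by (auto simp: card_1_singleton_iff card_2_iff)
  then show thesis using that * by cases auto
qed

lemma edge_total_mono:
  assumes "wf_network G" "\<And>x y. x \<in> nodes G \<Longrightarrow> y \<in> nodes G \<Longrightarrow> d x y \<le> d' x y"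
  shows "edge_total G d \<le> edge_total G d'"
  unfolding edge_total_def
proof (intro sum_mono divide_right_mono)
  fix e x y assume e: "e \<in> edges G" and "x \<in> ends G e" "y \<in> ends G e"
  moreover have "ends G e \<subseteq> nodes G" using assms(1) e by (auto simp: wf_network_def)
  ultimately show "d x y \<le> d' x y" using assms(2) by blast
qed simp

lemma edge_total_cong:
  assumes "wf_network G" "\<And>x y. x \<in> nodes G \<Longrightarrow> y \<in> nodes G \<Longrightarrow> d x y = d' x y"
  shows "edge_total G d = edge_total G d'"
  using edge_total_mono[OF assms(1), of d d'] edge_total_mono[OF assms(1), of d' d] assms(2) by force

lemma edge_total_add: "edge_total G (\<lambda>x y. d x y + d' x y) = edge_total G d + edge_total G d'"
  by (simp add: edge_total_def sum.distrib add_divide_distrib)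

lemma edge_total_diff: "edge_total G (\<lambda>x y. d x y - d' x y) = edge_total G d - edge_total G d'"
  by (simp add: edge_total_def sum_subtractf diff_divide_distrib)

lemma edge_total_scale: "edge_total G (\<lambda>x y. c * d x y) = c * edge_total G d"
  by (simp add: edge_total_def sum_distrib_left)

lemma edge_total_divide: "edge_total G (\<lambda>x y. d x y / c) = edge_total G d / c"
  using edge_total_scale[of G "1 / c" d] by simp

lemma edge_total_sum:
  "edge_total G (\<lambda>x y. \<Sum>i\<in>I. d i x y) = (\<Sum>i\<in>I. edge_total G (d i))"
proof (induction I rule: infinite_finite_induct)
  case (insert i I)
  then show ?case by (simp add: edge_total_add)
qed (simp_all add: edge_total_def)

lemma edge_sum_pair:
  fixes d :: "'v \<Rightarrow> 'v \<Rightarrow> real"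
  assumes "\<And>x. d x x = 0" "\<And>x y. d x y = d y x"
  shows "(\<Sum>u\<in>{x, y}. \<Sum>v\<in>{x, y}. d u v) / 2 = d x y"
  using assms by (cases "x = y") auto

lemma edge_total_eq_sum:
  assumes "wf_network G" "\<And>x. d x x = 0" "\<And>x y. d x y = d y x"
    and "\<And>e x y. e \<in> edges G \<Longrightarrow> ends G e = {x, y} \<Longrightarrow> l (ends G e) = d x y"
  shows "edge_total G d = (\<Sum>e\<in>edges G. l (ends G e))"
  unfolding edge_total_def
proof (intro sum.cong refl)
  fix e assume e: "e \<in> edges G"
  obtain x y where "ends G e = {x, y}" using wf_network_ends[OF assms(1) e] by metis
  then show "(\<Sum>x\<in>ends G e. \<Sum>y\<in>ends G e. d x y) / 2 = l (ends G e)"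
    using edge_sum_pair[of d x y] assms(2-4) e by simp
qed

definition separates :: "'v set \<Rightarrow> 'v \<Rightarrow> 'v \<Rightarrow> real" where
  "separates Z x y = (if (x \<in> Z) = (y \<in> Z) then 0 else 1)"

lemma cut_eq_edge_total:
  assumes "wf_network G"
  shows "real (cut G Z) = edge_total G (separates Z)"
proof -
  let ?l = "\<lambda>s. if s \<inter> Z \<noteq> {} \<and> s \<inter> (nodes G - Z) \<noteq> {} then 1 else (0 :: real)"
  have "edge_total G (separates Z) = (\<Sum>e\<in>edges G. ?l (ends G e))"
  proof (rule edge_total_eq_sum[OF assms])
    fix e x y assume e: "e \<in> edges G" "ends G e = {x, y}"
    then have "x \<in> nodes G" "y \<in> nodes G" using assms by (auto simp: wf_network_def)
    then show "?l (ends G e) = separates Z x y" using e by (auto simp: separates_def)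
  qed (auto simp: separates_def)
  also have "\<dots> = real (cut G Z)"
    using assms by (simp add: cut_def wf_network_def sum.If_cases Int_def)
  finally show ?thesis by simp
qed

text \<open>The inequality holds for every pair of nodes separately, with \<open>separates\<close>
  in place of \<open>cut\<close>.\<close>

lemma cut_submodular:
  assumes "wf_network G"
  shows "cut G (X \<inter> Y) + cut G (X \<union> Y) \<le> cut G X + cut G Y"
proof -
  have "edge_total G (\<lambda>x y. separates (X \<inter> Y) x y + separates (X \<union> Y) x y)
      \<le> edge_total G (\<lambda>x y. separates X x y + separates Y x y)"
    by (rule edge_total_mono[OF assms]) (auto simp: separates_def)
  then show ?thesis
    unfolding edge_total_add cut_eq_edge_total[OF assms, symmetric] by linarith
qed

lemma cut_posimodular:
  assumes "wf_network G"
  shows "cut G (X - Y) + cut G (Y - X) \<le> cut G X + cut G Y"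
proof -
  have "edge_total G (\<lambda>x y. separates (X - Y) x y + separates (Y - X) x y)
      \<le> edge_total G (\<lambda>x y. separates X x y + separates Y x y)"
    by (rule edge_total_mono[OF assms]) (auto simp: separates_def)
  then show ?thesis
    unfolding edge_total_add cut_eq_edge_total[OF assms, symmetric] by linarith
qed

lemma lambda_le_cut:
  assumes "wf_network G" "Z \<subseteq> nodes G"
  shows "lambda G (Z \<inter> terminals G) \<le> cut G Z"
proof -
  have "finite {cut G Z' |Z'. Z' \<subseteq> nodes G \<and> Z' \<inter> terminals G = Z \<inter> terminals G}"
    using assms(1) by (auto simp: wf_network_def)
  then show ?thesis unfolding lambda_def using assms(2) by (intro Min_le) auto
qed

lemma lambda_attained:
  assumes "wf_network G" "B \<subseteq> terminals G"
  shows "\<exists>Z. Z \<subseteq> nodes G \<and> Z \<inter> terminals G = B \<and> cut G Z = lambda G B"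
proof -
  let ?C = "{cut G Z |Z. Z \<subseteq> nodes G \<and> Z \<inter> terminals G = B}"
  have "finite ?C" using assms(1) by (auto simp: wf_network_def)
  moreover have "B \<subseteq> nodes G \<and> B \<inter> terminals G = B" using assms by (auto simp: wf_network_def)
  then have "cut G B \<in> ?C" by blast
  ultimately have "Min ?C \<in> ?C" by (intro Min_in) blast+
  then obtain Z where Z: "Z \<subseteq> nodes G" "Z \<inter> terminals G = B" and cut: "Min ?C = cut G Z" by blast
  show ?thesis unfolding lambda_def cut using Z by blast
qed

section \<open>Path sums and the linear program of multiflows\<close>

lemma finite_T_paths:
  assumes "wf_network G"
  shows "finite (T_paths G)"
proof -
  have fin: "finite (nodes G)" "finite (edges G)" using assms by (auto simp: wf_network_def)
  have "T_paths G \<subseteq> {vs. set vs \<subseteq> nodes G \<and> length vs \<le> Suc (card (edges G))}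
      \<times> {es. set es \<subseteq> edges G \<and> length es \<le> card (edges G)}"
    using fin by (auto simp: T_paths_def distinct_card[symmetric] intro: card_mono)
  then show ?thesis
    using finite_lists_length_le[OF fin(1)] finite_lists_length_le[OF fin(2)]
    by (meson finite_SigmaI finite_subset)
qed

lemma T_paths_end_pair:
  assumes "wf_network G" "p \<in> T_paths G"
  shows "end_pair p \<subseteq> terminals G" "card (end_pair p) = 2"
  using assms by (auto simp: T_paths_def end_pair_def)

lemma Theta_eq_sum_paths:
  assumes "wf_network G"
  shows "Theta G f = (\<Sum>p\<in>T_paths G. omega G (end_pair p) * f p)"
proof -
  let ?Q = "{q. q \<subseteq> terminals G \<and> card q = 2}"
  have fin: "finite ?Q" using assms
    by (auto simp: wf_network_def intro: finite_subset[of _ "Pow (terminals G)"] dest: finite_subset)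
  have "Theta G f = (\<Sum>q\<in>?Q. \<Sum>p\<in>{p\<in>T_paths G. end_pair p = q}. omega G (end_pair p) * f p)"
    unfolding Theta_def flow_between_def by (intro sum.cong) (auto simp: sum_distrib_left)
  also have "\<dots> = (\<Sum>p\<in>T_paths G. omega G (end_pair p) * f p)"
    using T_paths_end_pair[OF assms]
    by (intro sum.group[OF finite_T_paths[OF assms] fin]) auto
  finally show ?thesis .
qed

text \<open>The potential is arbitrary because it serves both as a distance from a fixed label and
  as a negated distance.\<close>

lemma walk_potential_le:
  fixes l :: "'v set \<Rightarrow> real"
  assumes "length vs = Suc (length es)" "set vs \<subseteq> nodes G" "set es \<subseteq> edges G"
    and "\<And>i. i < length es \<Longrightarrow> ends G (es ! i) = {vs ! i, vs ! Suc i}"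
    and "\<And>e x y. e \<in> edges G \<Longrightarrow> ends G e = {x, y} \<Longrightarrow> h y \<le> h x + l {x, y}"
  shows "h (last vs) \<le> h (hd vs) + (\<Sum>e\<leftarrow>es. l (ends G e))"
  using assms(1-4)
proof (induction es arbitrary: vs)
  case Nil
  then show ?case by (auto simp: length_Suc_conv)
next
  case (Cons e es)
  then obtain v vs' where vs: "vs = v # vs'" "length vs' = Suc (length es)"
    by (auto simp: length_Suc_conv)
  then have ne: "vs' \<noteq> []" by auto
  have "h (last vs') \<le> h (hd vs') + (\<Sum>e\<leftarrow>es. l (ends G e))"
  proof (rule Cons.IH)
    show "ends G (es ! i) = {vs' ! i, vs' ! Suc i}" if "i < length es" for i
      using Cons.prems(4)[of "Suc i"] that vs by simp
  qed (use Cons.prems vs in auto)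
  moreover have e: "ends G e = {v, hd vs'}"
    using Cons.prems(4)[of 0] vs ne by (simp add: hd_conv_nth)
  moreover have "h (hd vs') \<le> h v + l {v, hd vs'}"
    using assms(5)[OF _ e] Cons.prems(3) by simp
  ultimately show ?case using vs ne by simp
qed

text \<open>Capacities are imposed per pair of nodes, not per edge. So lengths depend on the end set
  only, and path lengths are regrouped by end sets.\<close>

lemma sum_list_by_ends:
  fixes l :: "'v set \<Rightarrow> real"
  assumes "finite E" "set es \<subseteq> E"
  shows "(\<Sum>e\<leftarrow>es. l (g e)) = (\<Sum>q\<in>g ` E. l q * real (length (filter (\<lambda>e. g e = q) es)))"
  using assms(2)
proof (induction es)
  case (Cons e es)
  have "(\<Sum>q\<in>g ` E. l q * real (length (filter (\<lambda>e. g e = q) (e # es))))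
      = (\<Sum>q\<in>g ` E. (if q = g e then l q else 0) + l q * real (length (filter (\<lambda>e. g e = q) es)))"
    by (intro sum.cong) (auto simp: algebra_simps)
  then show ?case using Cons assms(1) by (simp add: sum.distrib)
qed simp

lemma sum_edges_by_ends:
  fixes l :: "'v set \<Rightarrow> real"
  assumes "finite E"
  shows "(\<Sum>e\<in>E. l (g e)) = (\<Sum>q\<in>g ` E. l q * real (card {e \<in> E. g e = q}))"
proof -
  have "(\<Sum>e\<in>E. l (g e)) = (\<Sum>q\<in>g ` E. \<Sum>e\<in>{e\<in>E. g e = q}. l (g e))"
    by (rule sum.image_gen[OF assms])
  also have "\<dots> = (\<Sum>q\<in>g ` E. l q * real (card {e \<in> E. g e = q}))"
    by (intro sum.cong) auto
  finally show ?thesis .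
qed

text \<open>Weak duality: the length that the flow uses is bounded by the length available, pair by
  pair.\<close>

lemma multiflow_length_le:
  fixes l :: "'v set \<Rightarrow> real"
  assumes "wf_network G" "multiflow G f" "\<And>s. 0 \<le> l s"
  shows "(\<Sum>p\<in>T_paths G. (\<Sum>e\<leftarrow>snd p. l (ends G e)) * f p) \<le> (\<Sum>e\<in>edges G. l (ends G e))"
proof -
  let ?n = "\<lambda>p q. real (length (filter (\<lambda>e. ends G e = q) (snd p)))"
  have fin: "finite (edges G)" using assms(1) by (auto simp: wf_network_def)
  have "(\<Sum>p\<in>T_paths G. (\<Sum>e\<leftarrow>snd p. l (ends G e)) * f p)
      = (\<Sum>p\<in>T_paths G. \<Sum>q\<in>ends G ` edges G. l q * (?n p q * f p))"
    by (intro sum.cong refl, subst sum_list_by_ends[OF fin])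
       (auto simp: T_paths_def sum_distrib_right mult.assoc)
  also have "\<dots> = (\<Sum>q\<in>ends G ` edges G. l q * (\<Sum>p\<in>T_paths G. ?n p q * f p))"
    by (subst sum.swap) (simp add: sum_distrib_left)
  also have "\<dots> \<le> (\<Sum>q\<in>ends G ` edges G. l q * real (card {e \<in> edges G. ends G e = q}))"
  proof (intro sum_mono mult_left_mono assms(3))
    fix q assume "q \<in> ends G ` edges G"
    then obtain x y where "x \<in> nodes G" "y \<in> nodes G" "q = {x, y}"
      using wf_network_ends[OF assms(1)] by (metis imageE)
    then show "(\<Sum>p\<in>T_paths G. ?n p q * f p) \<le> real (card {e \<in> edges G. ends G e = q})"
      using assms(2) by (simp add: multiflow_def traversals_def)
  qed
  also have "\<dots> = (\<Sum>e\<in>edges G. l (ends G e))"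
    by (rule sum_edges_by_ends[OF fin, symmetric])
  finally show ?thesis .
qed

lemma exists_multiflow_ge:
  fixes G :: "('v, 'e) network"
  assumes wf: "wf_network G"
    and dual: "\<And>l :: 'v set \<Rightarrow> real. (\<And>q. 0 \<le> l q) \<Longrightarrow>
      (\<And>p. p \<in> T_paths G \<Longrightarrow> omega G (end_pair p) \<le> (\<Sum>e\<leftarrow>snd p. l (ends G e))) \<Longrightarrow>
      M \<le> (\<Sum>e\<in>edges G. l (ends G e))"
  shows "\<exists>f. multiflow G f \<and> M \<le> Theta G f"
proof -
  let ?Q = "ends G ` edges G"
  let ?n = "\<lambda>q p. real (length (filter (\<lambda>e. ends G e = q) (snd p)))"
  let ?c = "\<lambda>q. real (card {e \<in> edges G. ends G e = q})"
  have fin: "finite (edges G)" using wf by (auto simp: wf_network_def)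
  have "\<exists>f. (\<forall>p\<in>T_paths G. 0 \<le> f p) \<and> (\<forall>q\<in>?Q. (\<Sum>p\<in>T_paths G. ?n q p * f p) \<le> ?c q)
      \<and> M \<le> (\<Sum>p\<in>T_paths G. omega G (end_pair p) * f p)"
  proof (rule lp_duality)
    fix l :: "'v set \<Rightarrow> real"
    assume l: "\<And>q. q \<in> ?Q \<Longrightarrow> 0 \<le> l q"
      and p: "\<And>p. p \<in> T_paths G \<Longrightarrow> omega G (end_pair p) \<le> (\<Sum>q\<in>?Q. l q * ?n q p)"
    \<comment> \<open>Dual variables exist only for end sets of edges. The value 0 elsewhere makes
      \<open>l'\<close> nonnegative everywhere and changes no sum.\<close>
    define l' where "l' q = (if q \<in> ?Q then l q else 0)" for q
    have "M \<le> (\<Sum>e\<in>edges G. l' (ends G e))"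
    proof (rule dual)
      show "omega G (end_pair p) \<le> (\<Sum>e\<leftarrow>snd p. l' (ends G e))" if "p \<in> T_paths G" for p
      proof -
        have "set (snd p) \<subseteq> edges G" using that by (auto simp: T_paths_def)
        then show ?thesis using p[OF that] sum_list_by_ends[OF fin, of "snd p" l' "ends G"]
          by (simp add: l'_def)
      qed
    qed (simp add: l'_def l)
    then show "M \<le> (\<Sum>q\<in>?Q. l q * ?c q)"
      by (simp add: sum_edges_by_ends[OF fin, of l' "ends G"]) (simp add: l'_def)
  qed (use fin finite_T_paths[OF wf] in auto)
  then obtain f where f: "\<forall>p\<in>T_paths G. 0 \<le> f p"
    "\<And>q. q \<in> ?Q \<Longrightarrow> (\<Sum>p\<in>T_paths G. ?n q p * f p) \<le> ?c q"
    "M \<le> (\<Sum>p\<in>T_paths G. omega G (end_pair p) * f p)" by blast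
  \<comment> \<open>A pair joined by no edge is traversed by no path, so its left-hand side is
    0.\<close>
  have "(\<Sum>p\<in>T_paths G. ?n q p * f p) \<le> ?c q" for q
  proof (cases "q \<in> ?Q")
    case False
    have "?n q p * f p = 0" if "p \<in> T_paths G" for p
    proof -
      have "set (snd p) \<subseteq> edges G" using that by (auto simp: T_paths_def)
      then have "filter (\<lambda>e. ends G e = q) (snd p) = []" using False by (auto simp: filter_empty_conv)
      then show ?thesis by simp
    qed
    then have "(\<Sum>p\<in>T_paths G. ?n q p * f p) = 0" by (rule sum.neutral[OF ballI])
    then show ?thesis by simp
  qed (rule f(2))
  then have "multiflow G f" using f(1) by (simp add: multiflow_def traversals_def)
  then show ?thesis using f(3) Theta_eq_sum_paths[OF wf] by auto
qed

section \<open>Labellings and the tight span\<close>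

datatype 'v label = At 'v | Mid "'v set" | Centre

text \<open>Distances are measured in quarters, so that they are natural numbers.\<close>

fun qdist :: "('v, 'e) network \<Rightarrow> 'v label \<Rightarrow> 'v label \<Rightarrow> nat" where
  "qdist G (At s) (At t) = (if s = t then 0 else if {s, t} \<in> demands G then 4 else 2)"
| "qdist G (At t) (Mid A) = (if t \<in> A then 1 else 3)"
| "qdist G (Mid A) (At t) = (if t \<in> A then 1 else 3)"
| "qdist G (At t) Centre = 2"
| "qdist G Centre (At t) = 2"
| "qdist G (Mid A) (Mid B) = (if A = B then 0 else 2)"
| "qdist G (Mid A) Centre = 1"
| "qdist G Centre (Mid A) = 1"
| "qdist G Centre Centre = 0"

lemma qdist_refl [simp]: "qdist G a a = 0"
  by (cases a) auto

lemma qdist_sym: "qdist G a b = qdist G b a"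
  by (cases a; cases b) (auto simp: insert_commute)

definition labels :: "('v, 'e) network \<Rightarrow> 'v label set" where
  "labels G = At ` terminals G \<union> Mid ` anticliques G \<union> {Centre}"

definition labelling :: "('v, 'e) network \<Rightarrow> ('v \<Rightarrow> 'v label) \<Rightarrow> bool" where
  "labelling G \<rho> \<longleftrightarrow> (\<forall>v\<in>nodes G. \<rho> v \<in> labels G) \<and> (\<forall>t\<in>terminals G. \<rho> t = At t)"

definition cost :: "('v, 'e) network \<Rightarrow> ('v \<Rightarrow> 'v label) \<Rightarrow> real" where
  "cost G \<rho> = edge_total G (\<lambda>x y. real (qdist G (\<rho> x) (\<rho> y)) / 4)"

locale simple_K_network =
  fixes G :: "('v, 'e) network"
  assumes wf: "wf_network G"
    and flower: "\<And>A B C. A \<in> anticliques G \<Longrightarrow> B \<in> anticliques G \<Longrightarrow> C \<in> anticliques G \<Longrightarrow>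
      A \<noteq> B \<Longrightarrow> A \<noteq> C \<Longrightarrow> B \<noteq> C \<Longrightarrow> A \<inter> B \<noteq> {} \<Longrightarrow> A \<inter> C \<noteq> {} \<Longrightarrow> B \<inter> C \<noteq> {} \<Longrightarrow> A \<inter> B = A \<inter> C"
    and simple: "simple_anticliques G"
begin

abbreviation "T \<equiv> terminals G"
abbreviation "K \<equiv> anticliques G"
abbreviation demand :: "'v \<Rightarrow> 'v \<Rightarrow> bool" where "demand s t \<equiv> {s, t} \<in> demands G"

section \<open>Intersections of anticliques\<close>

lemma finite_nodes: "finite (nodes G)" and finite_edges: "finite (edges G)"
  and T_subset_nodes: "T \<subseteq> nodes G"
  using wf by (auto simp: wf_network_def)

lemma finite_T: "finite T"
  using finite_nodes T_subset_nodes finite_subset by blast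

lemma anticlique_subset: "A \<in> K \<Longrightarrow> A \<subseteq> T"
  by (auto simp: anticliques_def stable_def)

lemma finite_K: "finite K"
  using finite_T anticlique_subset by (meson PowI finite_Pow_iff finite_subset subsetI)

lemma finite_anticlique: "A \<in> K \<Longrightarrow> finite A"
  using anticlique_subset finite_T finite_subset by blast

lemma not_demand: "A \<in> K \<Longrightarrow> s \<in> A \<Longrightarrow> t \<in> A \<Longrightarrow> \<not> demand s t"
  by (auto simp: anticliques_def stable_def)

lemma demand_sym: "demand s t \<longleftrightarrow> demand t s"
  by (simp add: insert_commute)

lemma not_demand_refl: "\<not> demand t t"
  using wf by (auto simp: wf_network_def)

lemma stable_extends:
  assumes "stable G A" shows "\<exists>B\<in>K. A \<subseteq> B"
proof -
  have "finite {B. stable G B}"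
    using finite_T by (auto simp: stable_def intro: finite_subset[of _ "Pow T"])
  from finite_has_maximal2[OF this, of A] assms
  obtain B where "stable G B" "A \<subseteq> B" "\<forall>C. stable G C \<longrightarrow> B \<subseteq> C \<longrightarrow> B = C" by auto
  then show ?thesis by (auto simp: anticliques_def)
qed

lemma anticlique_pair:
  assumes "s \<in> T" "t \<in> T" "\<not> demand s t"
  shows "\<exists>A\<in>K. s \<in> A \<and> t \<in> A"
proof -
  have "stable G {s, t}"
    using assms not_demand_refl by (auto simp: stable_def demand_sym)
  from stable_extends[OF this] show ?thesis by auto
qed

text \<open>Simplicity yields a third anticlique \<open>D\<close> with exactly one of
  \<open>s\<close>, \<open>t\<close>. It meets both \<open>A\<close> and \<open>B\<close>, so
  \<open>A \<inter> B = A \<inter> D\<close>; but the left side contains both terminals.\<close>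

lemma anticlique_unique:
  assumes "A \<in> K" "B \<in> K" "s \<in> A" "t \<in> A" "s \<in> B" "t \<in> B" "s \<noteq> t"
  shows "A = B"
proof (rule ccontr)
  assume ne: "A \<noteq> B"
  have "s \<in> T" "t \<in> T" using assms anticlique_subset by auto
  then obtain D where D: "D \<in> K" "(s \<in> D) \<noteq> (t \<in> D)"
    using simple assms(7) by (auto simp: simple_anticliques_def)
  then have "A \<noteq> D" "B \<noteq> D" "A \<inter> D \<noteq> {}" "B \<inter> D \<noteq> {}" "A \<inter> B \<noteq> {}" using assms by auto
  from flower[OF assms(1,2) D(1) ne this(1,2,5,3,4)] D(2) assms show False by blast
qed

text \<open>Otherwise anticliques \<open>B\<close> through \<open>x\<close>, \<open>z\<close> and
  \<open>C\<close> through \<open>y\<close>, \<open>z\<close> meet each other and \<open>A\<close>.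
  Then \<open>A \<inter> B = A \<inter> C\<close> contains both \<open>x\<close> and
  \<open>y\<close>, which forces \<open>A = C\<close>.\<close>

lemma outside_demand:
  assumes "A \<in> K" "z \<in> T" "z \<notin> A" "x \<in> A" "y \<in> A" "x \<noteq> y"
  shows "demand x z \<or> demand y z"
proof (rule ccontr)
  assume no: "\<not> ?thesis"
  have xy: "x \<in> T" "y \<in> T" using assms anticlique_subset by auto
  obtain B where B: "B \<in> K" "x \<in> B" "z \<in> B"
    using no anticlique_pair[OF xy(1) assms(2)] by blast
  obtain C where C: "C \<in> K" "y \<in> C" "z \<in> C"
    using no anticlique_pair[OF xy(2) assms(2)] by blast
  have "A \<noteq> B" "A \<noteq> C" using B C assms by auto
  moreover have "B \<noteq> C" using anticlique_unique[of A B x y] assms B C by auto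
  ultimately have "A \<inter> B = A \<inter> C"
    using flower[OF assms(1) B(1) C(1)] B C assms(4,5) by blast
  then have "A = C" using anticlique_unique[of A C x y] assms B C by auto
  with \<open>A \<noteq> C\<close> show False ..
qed

text \<open>Uniqueness of the common anticlique excludes the value 0 of
  \<open>omega\<close>.\<close>

lemma omega_pair:
  assumes "s \<in> T" "t \<in> T" "s \<noteq> t"
  shows "omega G {s, t} = real (qdist G (At s) (At t)) / 4"
proof (cases "demand s t")
  case False
  then obtain A where A: "A \<in> K" "s \<in> A" "t \<in> A" using anticlique_pair assms by blast
  have "{B \<in> K. {s, t} \<subseteq> B} = {A}" using A anticlique_unique[OF A(1)] assms(3) by auto
  then show ?thesis using False assms(3) by (simp add: omega_def)
qed (use assms in \<open>simp add: omega_def\<close>)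

text \<open>The critical case is the route from one terminal of \<open>A\<close> over
  \<open>Mid A\<close> to another. Its length is 2, and \<open>A\<close> being stable keeps the two
  terminals from being a demand pair.\<close>

lemma qdist_triangle:
  assumes "a \<in> labels G" "b \<in> labels G" "c \<in> labels G"
  shows "qdist G a c \<le> qdist G a b + qdist G b c"
  using assms by (cases a; cases b; cases c) (auto simp: labels_def not_demand)

text \<open>A labelling is a dual solution: measure every edge by the distance of the labels of its
  ends. By the triangle inequality each T-path is then at least as long as the \<open>omega\<close>
  of its end pair.\<close>

lemma Theta_le_cost:
  assumes "multiflow G f" "labelling G \<rho>"
  shows "Theta G f \<le> cost G \<rho>"
proof -
  define d where "d x y = real (qdist G (\<rho> x) (\<rho> y)) / 4" for x y
  define l where "l S = (\<Sum>x\<in>S. \<Sum>y\<in>S. d x y) / 2" for S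
  have l: "l {x, y} = d x y" for x y
    unfolding l_def by (rule edge_sum_pair) (auto simp: d_def qdist_sym)
  have "omega G (end_pair p) \<le> (\<Sum>e\<leftarrow>snd p. l (ends G e))" if "p \<in> T_paths G" for p
  proof -
    obtain vs es where p: "p = (vs, es)" by (cases p)
    let ?s = "hd vs"
    have st: "?s \<in> T" "last vs \<in> T" "?s \<noteq> last vs" using that p by (auto simp: T_paths_def)
    have "d ?s (last vs) \<le> d ?s ?s + (\<Sum>e\<leftarrow>es. l (ends G e))"
    proof (rule walk_potential_le[where G = G])
      fix e x y assume e: "e \<in> edges G" "ends G e = {x, y}"
      then have "x \<in> nodes G" "y \<in> nodes G" using wf by (auto simp: wf_network_def)
      then have "real (qdist G (\<rho> ?s) (\<rho> y)) \<le> real (qdist G (\<rho> ?s) (\<rho> x) + qdist G (\<rho> x) (\<rho> y))"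
        using assms(2) st(1) T_subset_nodes
        unfolding labelling_def by (intro of_nat_mono qdist_triangle) blast+
      then show "d ?s y \<le> d ?s x + l {x, y}" unfolding l by (simp add: d_def add_divide_distrib[symmetric])
    qed (use that p in \<open>auto simp: T_paths_def\<close>)
    moreover have "d ?s (last vs) = omega G (end_pair p)"
      using st assms(2) p omega_pair by (simp add: d_def end_pair_def labelling_def)
    ultimately show ?thesis using p by (simp add: d_def)
  qed
  moreover have "0 \<le> f p" if "p \<in> T_paths G" for p using that assms(1) by (simp add: multiflow_def)
  ultimately have "Theta G f \<le> (\<Sum>p\<in>T_paths G. (\<Sum>e\<leftarrow>snd p. l (ends G e)) * f p)"
    unfolding Theta_eq_sum_paths[OF wf] by (intro sum_mono mult_right_mono) auto
  also have "\<dots> \<le> (\<Sum>e\<in>edges G. l (ends G e))"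
    by (rule multiflow_length_le[OF wf assms(1)]) (auto simp: l_def d_def intro!: sum_nonneg)
  also have "\<dots> = cost G \<rho>" by (simp add: cost_def edge_total_def l_def d_def)
  finally show ?thesis .
qed

section \<open>Admissible functions and the retraction to the tight span\<close>

abbreviation req :: "'v \<Rightarrow> 'v \<Rightarrow> real" where "req s t \<equiv> (if demand s t then 1 else 1 / 2)"

definition admissible :: "('v \<Rightarrow> real) \<Rightarrow> bool" where
  "admissible p \<longleftrightarrow> (\<forall>x\<in>T. 0 \<le> p x) \<and> (\<forall>x\<in>T. \<forall>y\<in>T. x \<noteq> y \<longrightarrow> req x y \<le> p x + p y)"

text \<open>A function that is tight at all terminals is pointwise minimal among the admissible
  ones, that is, a point of the tight span.\<close>

definition tight :: "('v \<Rightarrow> real) \<Rightarrow> 'v \<Rightarrow> bool" where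
  "tight p x \<longleftrightarrow> p x = 0 \<or> (\<exists>y\<in>T. y \<noteq> x \<and> p x + p y = req x y)"

text \<open>The least value at \<open>x\<close> that keeps the function admissible when its other
  values stay fixed.\<close>

definition lower :: "('v \<Rightarrow> real) \<Rightarrow> 'v \<Rightarrow> real" where
  "lower p x = Max (insert 0 ((\<lambda>y. req x y - p y) ` (T - {x})))"

lemma lower_le_iff: "lower p x \<le> c \<longleftrightarrow> 0 \<le> c \<and> (\<forall>y\<in>T. y \<noteq> x \<longrightarrow> req x y - p y \<le> c)"
  unfolding lower_def using finite_T by (subst Max_le_iff) auto

lemma lower_ge: "0 \<le> lower p x" "y \<in> T \<Longrightarrow> y \<noteq> x \<Longrightarrow> req x y - p y \<le> lower p x"
proof -
  have "0 \<le> lower p x \<and> (\<forall>y\<in>T. y \<noteq> x \<longrightarrow> req x y - p y \<le> lower p x)"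
    unfolding lower_le_iff[symmetric] by (rule order_refl)
  then show "0 \<le> lower p x" "y \<in> T \<Longrightarrow> y \<noteq> x \<Longrightarrow> req x y - p y \<le> lower p x" by blast+
qed

lemma lower_attained: "lower p x = 0 \<or> (\<exists>y\<in>T. y \<noteq> x \<and> lower p x = req x y - p y)"
proof -
  have "lower p x \<in> insert 0 ((\<lambda>y. req x y - p y) ` (T - {x}))"
    unfolding lower_def using finite_T by (intro Max_in) auto
  then show ?thesis by auto
qed

lemma admissible_nonneg: "admissible p \<Longrightarrow> x \<in> T \<Longrightarrow> 0 \<le> p x"
  unfolding admissible_def by blast

lemma admissible_ge:
  "admissible p \<Longrightarrow> x \<in> T \<Longrightarrow> y \<in> T \<Longrightarrow> x \<noteq> y \<Longrightarrow> req x y \<le> p x + p y"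
  unfolding admissible_def by blast

lemma lower_le:
  assumes "admissible p" "x \<in> T"
  shows "lower p x \<le> p x"
  unfolding lower_le_iff
proof (intro conjI ballI impI)
  fix y assume "y \<in> T" "y \<noteq> x"
  then have "req x y \<le> p x + p y" using admissible_ge[OF assms, of y] by blast
  then show "req x y - p y \<le> p x" by linarith
qed (rule admissible_nonneg[OF assms])

text \<open>A maximum of functions that do not expand the sup norm does not expand it either. Hence
  the retraction keeps adjacent nodes within the length of their edge.\<close>

lemma lower_lipschitz:
  assumes "0 \<le> D" "\<And>y. y \<in> T \<Longrightarrow> \<bar>p y - q y\<bar> \<le> D"
  shows "\<bar>lower p x - lower q x\<bar> \<le> D"
proof -
  have *: "lower p x \<le> lower q x + D" if "\<And>y. y \<in> T \<Longrightarrow> \<bar>p y - q y\<bar> \<le> D" for p q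
    using lower_ge(1)[of q x] lower_ge(2)[of _ x q] that assms(1)
    by (subst lower_le_iff) (auto simp: abs_le_iff, smt+)
  show ?thesis using *[of p q] *[of q p] assms(2) by (auto simp: abs_le_iff abs_minus_commute)
qed

lemma admissible_lower:
  assumes "admissible p" "x \<in> T"
  shows "admissible (p(x := lower p x))"
proof -
  have "req a b \<le> (p(x := lower p x)) a + (p(x := lower p x)) b" if "a \<in> T" "b \<in> T" "a \<noteq> b" for a b
    using that assms lower_ge(2)[of a x p] lower_ge(2)[of b x p]
    by (cases "a = x"; cases "b = x") (auto simp: admissible_def insert_commute)
  then show ?thesis using assms lower_ge(1) by (auto simp: admissible_def)
qed

lemma tight_lower_self: "tight (p(x := lower p x)) x"
proof -
  consider "lower p x = 0" | y where "y \<in> T" "y \<noteq> x" "lower p x = req x y - p y"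
    using lower_attained[of p x] by blast
  then show ?thesis
  proof cases
    case 2
    then have "(p(x := lower p x)) x + (p(x := lower p x)) y = req x y" by simp
    then show ?thesis unfolding tight_def using 2(1,2) by blast
  qed (simp add: tight_def)
qed

lemma tight_lower_other:
  assumes p: "admissible p" and x: "x \<in> T" and z: "z \<in> T" "tight p z" "z \<noteq> x"
  shows "tight (p(x := lower p x)) z"
proof -
  let ?q = "p(x := lower p x)"
  consider "p z = 0" | y where "y \<in> T" "y \<noteq> z" "p z + p y = req z y"
    using z(2) by (auto simp: tight_def)
  then show ?thesis
  proof cases
    case 1
    then show ?thesis using z(3) by (simp add: tight_def)
  next
    case 2
    have "?q z + ?q y = req z y"
    proof (rule antisym)
      show "?q z + ?q y \<le> req z y" using 2 lower_le[OF p x] z(3) by auto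
      show "req z y \<le> ?q z + ?q y"
        using admissible_lower[OF p x] z(1) 2(1,2) by (auto simp: admissible_def)
    qed
    then show ?thesis unfolding tight_def using 2(1,2) by blast
  qed
qed

text \<open>Lowering the coordinates one after the other: a coordinate that has become tight stays tight, since
  admissibility keeps its partner from being lowered later.\<close>

lemma exists_tight_retraction:
  assumes "S \<subseteq> T"
  shows "\<exists>r. (\<forall>p. admissible p \<longrightarrow>
        admissible (r p) \<and> (\<forall>x\<in>S. tight (r p) x) \<and> (\<forall>x\<in>T. r p x \<le> p x)) \<and>
      (\<forall>p q D. (\<forall>x\<in>T. \<bar>p x - q x\<bar> \<le> D) \<longrightarrow> (\<forall>x\<in>T. \<bar>r p x - r q x\<bar> \<le> D))"
  using finite_subset[OF assms finite_T] assms
proof (induction S rule: finite_induct)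
  case empty
  show ?case by (rule exI[of _ "\<lambda>p. p"]) auto
next
  case (insert a S)
  then obtain r where
    r: "\<And>p. admissible p \<Longrightarrow> admissible (r p) \<and> (\<forall>x\<in>S. tight (r p) x) \<and> (\<forall>x\<in>T. r p x \<le> p x)"
    and lip: "\<And>p q D. (\<forall>x\<in>T. \<bar>p x - q x\<bar> \<le> D) \<Longrightarrow> (\<forall>x\<in>T. \<bar>r p x - r q x\<bar> \<le> D)"
    by auto
  have a: "a \<in> T" using insert.prems by simp
  let ?r = "\<lambda>p. (r p)(a := lower (r p) a)"
  have r': "admissible (?r p) \<and> (\<forall>x\<in>insert a S. tight (?r p) x) \<and> (\<forall>x\<in>T. ?r p x \<le> p x)"
    if "admissible p" for p
  proof (intro conjI ballI)
    have rp: "admissible (r p)" using r[OF that] by blast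
    show "admissible (?r p)" by (rule admissible_lower[OF rp a])
    show "tight (?r p) x" if "x \<in> insert a S" for x
    proof (cases "x = a")
      case True
      show ?thesis unfolding True by (rule tight_lower_self)
    next
      case False
      then have "x \<in> T" "tight (r p) x" using that insert.prems r[OF \<open>admissible p\<close>] by auto
      then show ?thesis using tight_lower_other[OF rp a] False by blast
    qed
    show "?r p x \<le> p x" if "x \<in> T" for x
      using lower_le[OF rp a] r[OF \<open>admissible p\<close>] that a by (auto intro: order_trans)
  qed
  have lip': "\<forall>x\<in>T. \<bar>?r p x - ?r q x\<bar> \<le> D" if "\<forall>x\<in>T. \<bar>p x - q x\<bar> \<le> D" for p q D
  proof -
    have "0 \<le> D" using that a by force
    then have "\<bar>lower (r p) a - lower (r q) a\<bar> \<le> D"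
      by (rule lower_lipschitz) (use lip[OF that] in blast)
    then show ?thesis using lip[OF that] by simp
  qed
  show ?case
  proof (rule exI[of _ ?r], rule conjI)
    show "\<forall>p. admissible p \<longrightarrow> admissible (?r p) \<and> (\<forall>x\<in>insert a S. tight (?r p) x) \<and>
        (\<forall>x\<in>T. ?r p x \<le> p x)" using r' by (intro allI impI)
    show "\<forall>p q D. (\<forall>x\<in>T. \<bar>p x - q x\<bar> \<le> D) \<longrightarrow> (\<forall>x\<in>T. \<bar>?r p x - ?r q x\<bar> \<le> D)"
      using lip' by (intro allI impI)
  qed
qed

end

section \<open>Threshold rounding\<close>

definition step_fun :: "real \<Rightarrow> real \<Rightarrow> real" where
  "step_fun a \<alpha> = (if a \<le> \<alpha> then 1 else 0)"

lemma step_fun_integral: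
  assumes "0 \<le> a" "a \<le> 1 / 4"
  shows "(step_fun a has_integral (1 / 4 - a)) {0..1/4}"
proof -
  have "((\<lambda>_. 1 :: real) has_integral (1 / 4 - a)) {a..1/4}"
    using has_integral_const_real[of "1 :: real" a "1/4"] assms by simp
  then have "((\<lambda>x. if x \<in> {a..1/4} then 1 else (0 :: real)) has_integral (1 / 4 - a)) {0..1/4}"
    using assms by (subst has_integral_restrict) auto
  then show ?thesis
    by (rule has_integral_eq[rotated]) (auto simp: step_fun_def)
qed

text \<open>The two steps differ exactly for thresholds between \<open>a\<close> and
  \<open>b\<close>.\<close>

lemma step_fun_diff_integral:
  assumes "0 \<le> a" "a \<le> 1 / 4" "0 \<le> b" "b \<le> 1 / 4"
  shows "((\<lambda>\<alpha>. \<bar>step_fun a \<alpha> - step_fun b \<alpha>\<bar>) has_integral \<bar>a - b\<bar>) {0..1/4}"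
proof -
  have *: "((\<lambda>\<alpha>. \<bar>step_fun a \<alpha> - step_fun b \<alpha>\<bar>) has_integral \<bar>a - b\<bar>) {0..1/4}"
    if "0 \<le> a" "a \<le> b" "b \<le> 1 / 4" for a b
  proof (rule has_integral_eq)
    show "((\<lambda>\<alpha>. step_fun a \<alpha> - step_fun b \<alpha>) has_integral \<bar>a - b\<bar>) {0..1/4}"
      using has_integral_diff[OF step_fun_integral[of a] step_fun_integral[of b]] that by simp
    show "step_fun a \<alpha> - step_fun b \<alpha> = \<bar>step_fun a \<alpha> - step_fun b \<alpha>\<bar>" for \<alpha>
      using that by (simp add: step_fun_def)
  qed
  show ?thesis
    using *[of a b] *[of b a] assms by (cases "a \<le> b") (simp_all add: abs_minus_commute)
qed

text \<open>For \<open>w \<le> u\<close> the pair of steps at \<open>u\<close> and \<open>w\<close>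
  takes only the values (1,1), (0,1), (0,0). They stand for \<open>At t\<close>,
  \<open>Mid A\<close>, \<open>Centre\<close>, and within one triangle \<open>qdist\<close> is their
  l1 distance.\<close>

definition round_label :: "real \<Rightarrow> 'v \<Rightarrow> 'v set \<Rightarrow> real \<Rightarrow> real \<Rightarrow> 'v label" where
  "round_label \<alpha> t A w u = (if u \<le> \<alpha> then At t else if w \<le> \<alpha> then Mid A else Centre)"

context simple_K_network
begin

lemma anticlique_subset_eq: "A \<in> K \<Longrightarrow> B \<in> K \<Longrightarrow> A \<subseteq> B \<Longrightarrow> A = B"
  by (auto simp: anticliques_def)

text \<open>Affine coordinates on a triangle of the tight span. \<open>At t\<close>,
  \<open>Mid A\<close>, \<open>Centre\<close> have (\<open>u\<close>, \<open>w\<close>) equal to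
  (0,0), (1/4,0), (1/4,1/4), where the formula gives a quarter of \<open>qdist\<close> to
  \<open>At x\<close>.\<close>

definition normal_form :: "'v \<Rightarrow> 'v set \<Rightarrow> real \<Rightarrow> real \<Rightarrow> 'v \<Rightarrow> real" where
  "normal_form t A w u x = (if x = t then u + w else if x \<in> A then 1 / 2 - u + w
     else if demand x t then 1 - u - w else 1 / 2 + u - w)"

text \<open>If \<open>A = {t}\<close>, then \<open>t\<close> is in demand with every other terminal
  and only \<open>u + w\<close> matters; \<open>w = u\<close> fixes the choice.\<close>

definition valid_form :: "'v \<Rightarrow> 'v set \<Rightarrow> real \<Rightarrow> real \<Rightarrow> bool" where
  "valid_form t A w u \<longleftrightarrow> A \<in> K \<and> t \<in> A \<and> 0 \<le> w \<and> w \<le> u \<and> u \<le> 1 / 4 \<and> (A = {t} \<longrightarrow> w = u)"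

text \<open>Such functions lie on the edge between \<open>At t\<close> and \<open>Centre\<close>,
  where \<open>w = u\<close>. All triangles of anticliques through \<open>t\<close> share this edge,
  so any such \<open>A\<close> will do.\<close>

lemma tight_normal_form_star:
  assumes p: "admissible p" and tight: "\<And>x. x \<in> T \<Longrightarrow> tight p x"
    and t: "t \<in> T" and half: "\<And>x. x \<in> T \<Longrightarrow> x \<noteq> t \<Longrightarrow> 1 / 2 \<le> p x"
  shows "\<exists>A w u. valid_form t A w u \<and> (\<forall>x\<in>T. p x = normal_form t A w u x)"
proof -
  obtain A where A: "A \<in> K" "t \<in> A"
    using anticlique_pair[OF t t not_demand_refl] by blast
  have t0: "0 \<le> p t" using admissible_nonneg[OF p t] .
  have t1: "p t \<le> 1 / 2"
  proof (cases "p t = 0")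
    case False
    then obtain y where "y \<in> T" "y \<noteq> t" "p t + p y = req t y"
      using tight[OF t] unfolding tight_def by blast
    then show ?thesis using half[of y] by (auto split: if_splits)
  qed simp
  have "p x = normal_form t A (p t / 2) (p t / 2) x" if x: "x \<in> T" for x
  proof (cases "x = t")
    case False
    then have "1 / 2 \<le> p x" using half x by blast
    then obtain y where y: "y \<in> T" "y \<noteq> x" "p x + p y = req x y"
      using tight[OF x] unfolding tight_def by auto
    have px: "p x = (if demand x t then 1 - p t else 1 / 2)"
    proof (cases "y = t")
      case True
      then show ?thesis using y t0 \<open>1 / 2 \<le> p x\<close> by (auto split: if_splits)
    next
      case ne: False
      have "p x = 1 / 2" using half[OF y(1) ne] y(3) \<open>1 / 2 \<le> p x\<close> by (auto split: if_splits)
      then show ?thesis using admissible_ge[OF p x t False] t1 by (auto split: if_splits)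
    qed
    show ?thesis
    proof (cases "x \<in> A")
      case True
      then show ?thesis using px False not_demand[OF A(1) True A(2)] by (simp add: normal_form_def)
    next
      case ne: False
      then show ?thesis using px False by (simp add: normal_form_def)
    qed
  qed (simp add: normal_form_def)
  moreover have "valid_form t A (p t / 2) (p t / 2)"
    using A t0 t1 by (simp add: valid_form_def)
  ultimately show ?thesis by blast
qed

text \<open>Otherwise at least two terminals are below 1/2. All terminals below 1/2 form a stable
  set, so they lie in an anticlique \<open>A\<close>. If \<open>t\<close> minimises \<open>p\<close>
  on \<open>A\<close>, then \<open>p\<close> is constant on the rest of \<open>A\<close>, and
  tightness determines it outside \<open>A\<close>.\<close>

lemma tight_normal_form:
  assumes p: "admissible p" and tight: "\<And>x. x \<in> T \<Longrightarrow> tight p x" and ne: "T \<noteq> {}"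
  shows "\<exists>t A w u. valid_form t A w u \<and> (\<forall>x\<in>T. p x = normal_form t A w u x)"
proof (cases "\<exists>t\<in>T. \<forall>x\<in>T. x \<noteq> t \<longrightarrow> 1 / 2 \<le> p x")
  case True
  then obtain t where "t \<in> T" "\<And>x. x \<in> T \<Longrightarrow> x \<noteq> t \<Longrightarrow> 1 / 2 \<le> p x" by blast
  from tight_normal_form_star[OF p tight this] show ?thesis by blast
next
  case False
  then have two: "\<exists>x\<in>T. x \<noteq> t \<and> p x < 1 / 2" if "t \<in> T" for t using that by force
  obtain x1 where x1: "x1 \<in> T" "p x1 < 1 / 2" using two ne by blast
  obtain x2 where x2: "x2 \<in> T" "x2 \<noteq> x1" "p x2 < 1 / 2" using two[OF x1(1)] by blast
  have "stable G {x \<in> T. p x < 1 / 2}"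
    unfolding stable_def
  proof (intro conjI ballI)
    fix x y assume xy: "x \<in> {x \<in> T. p x < 1 / 2}" "y \<in> {x \<in> T. p x < 1 / 2}"
    show "\<not> demand x y"
    proof
      assume d: "demand x y"
      then have "x \<noteq> y" using not_demand_refl by metis
      then show False using admissible_ge[OF p, of x y] xy d by simp
    qed
  qed auto
  then obtain A where A: "A \<in> K" and low: "\<And>x. x \<in> T \<Longrightarrow> p x < 1 / 2 \<Longrightarrow> x \<in> A"
    using stable_extends by blast
  have AT: "x \<in> T" if "x \<in> A" for x using that anticlique_subset[OF A] by blast
  have partner: "\<exists>y\<in>T. y \<noteq> z \<and> p z + p y = req z y \<and> p y > 0" if z: "z \<in> T" for z
  proof -
    have pos: "p z > 0" if z: "z \<in> T" for z
    proof -
      obtain x where x: "x \<in> T" "x \<noteq> z" "p x < 1 / 2" using two[OF z] by blast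
      have "req x z \<ge> 1 / 2" by simp
      then show ?thesis using admissible_ge[OF p x(1) z x(2)] x(3) by linarith
    qed
    then show ?thesis using tight[OF z] pos[OF z] unfolding tight_def by force
  qed
  have out: "1 / 2 < p z" if z: "z \<in> T" "z \<notin> A" for z
  proof -
    consider "demand x1 z" | "demand x2 z"
      using outside_demand[OF A z, of x1 x2] low x1 x2 by blast
    then show ?thesis
    proof cases
      case 1
      then have "x1 \<noteq> z" using not_demand_refl by metis
      then show ?thesis using admissible_ge[OF p x1(1) z(1)] x1(2) 1 by simp
    next
      case 2
      then have "x2 \<noteq> z" using not_demand_refl by metis
      then show ?thesis using admissible_ge[OF p x2(1) z(1)] x2(3) 2 by simp
    qed
  qed
  have ins: "p y < 1 / 2" if y: "y \<in> A" for y
  proof (rule ccontr)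
    assume "\<not> p y < 1 / 2"
    moreover obtain z where z: "z \<in> T" "p y + p z = req y z" "p z > 0" using partner[OF AT[OF y]] by blast
    ultimately show False
      using out[OF z(1)] not_demand[OF A y] by (cases "z \<in> A") (auto split: if_splits)
  qed
  obtain t where t: "t \<in> A" "\<And>x. x \<in> A \<Longrightarrow> p t \<le> p x"
  proof -
    have "x1 \<in> A" using low x1 by blast
    then have "Min (p ` A) \<in> p ` A" using finite_anticlique[OF A] by (intro Min_in) auto
    then obtain t where "t \<in> A" "p t = Min (p ` A)" by auto
    then show thesis using finite_anticlique[OF A] by (intro that[of t]) auto
  qed
  obtain x0 where x0: "x0 \<in> A" "x0 \<noteq> t" using low x1 x2 by metis
  have inA: "1 / 2 \<le> p x + p y" if "x \<in> A" "y \<in> A" "x \<noteq> y" for x y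
    using admissible_ge[OF p AT[OF that(1)] AT[OF that(2)] that(3)] not_demand[OF A that(1,2)] by simp
  \<comment> \<open>A partner \<open>y\<close> of \<open>x\<close> inside \<open>A\<close> gives
    \<open>p x = 1 / 2 - p y\<close>, at most \<open>1 / 2 - p t\<close> and so at most
    \<open>p x'\<close>. A partner outside is in demand with \<open>x'\<close> or \<open>t\<close>,
    which gives the bound \<open>p x'\<close> or \<open>p t\<close>.\<close>
  have le: "p x \<le> p x'" if x: "x \<in> A" "x \<noteq> t" and x': "x' \<in> A" "x' \<noteq> t" for x x'
  proof -
    obtain y where y: "y \<in> T" "y \<noteq> x" "p x + p y = req x y" using partner[OF AT[OF x(1)]] by blast
    show ?thesis
    proof (cases "y \<in> A")
      case True
      then have "p x + p y = 1 / 2" using y(3) not_demand[OF A x(1) True] by simp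
      moreover have "p t \<le> p y" using t(2)[OF True] .
      moreover have "1 / 2 \<le> p t + p x'" using inA[OF t(1) x'(1)] x'(2) by blast
      ultimately show ?thesis by linarith
    next
      case False
      have "p y > 1 / 2" using out[OF y(1) False] .
      then have eq: "p x + p y = 1"
        using y(3) admissible_nonneg[OF p AT[OF x(1)]] by (auto split: if_splits)
      have "1 \<le> p x' + p y \<or> 1 \<le> p t + p y"
      proof -
        have "demand x' y \<or> demand t y"
          by (rule outside_demand[OF A y(1) False x'(1) t(1) x'(2)])
        moreover have "x' \<noteq> y" "t \<noteq> y" using False x' t by auto
        ultimately show ?thesis
          using admissible_ge[OF p AT[OF x'(1)] y(1)] admissible_ge[OF p AT[OF t(1)] y(1)] by auto
      qed
      then show ?thesis using eq t(2)[OF x'(1)] by linarith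
    qed
  qed
  define b where "b = p x0"
  have b: "p x = b" if "x \<in> A" "x \<noteq> t" for x
    using le[OF that x0] le[OF x0 that] by (simp add: b_def)
  have outside: "p z = (if demand z t then 1 - p t else 1 - b)" if z: "z \<in> T" "z \<notin> A" for z
  proof -
    have zt: "z \<noteq> t" using z t by blast
    obtain y where y: "y \<in> T" "y \<noteq> z" "p z + p y = req z y" "p y > 0" using partner[OF z(1)] by blast
    have "y \<in> A" using out[OF z] out[OF y(1)] y(3) by (cases "y \<in> A") (auto split: if_splits)
    have dem: "demand z y" and eq: "p z + p y = 1"
      using out[OF z] y(3,4) by (auto split: if_splits)
    show ?thesis
    proof (cases "demand z t")
      case True
      then have "1 \<le> p z + p t" using admissible_ge[OF p z(1) AT[OF t(1)] zt] by simp
      then show ?thesis using True eq t(2)[OF \<open>y \<in> A\<close>] by simp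
    next
      case False
      then have "y \<noteq> t" using dem by blast
      then show ?thesis using False eq b[OF \<open>y \<in> A\<close>] by simp
    qed
  qed
  \<comment> \<open>The solution of \<open>u + w = p t\<close> and
    \<open>1 / 2 - u + w = b\<close>.\<close>
  define u where "u = (p t + 1 / 2 - b) / 2"
  define w where "w = (p t + b - 1 / 2) / 2"
  have "valid_form t A w u"
    using A t x0 ins[OF x0(1)] inA[OF t(1) x0(1)]
    by (auto simp: valid_form_def u_def w_def b_def)
  moreover have "p x = normal_form t A w u x" if "x \<in> T" for x
    using b[of x] outside[OF that] by (auto simp: normal_form_def u_def w_def field_simps)
  ultimately show ?thesis by blast
qed

text \<open>The differences at \<open>t\<close>, \<open>s\<close> and at most one further terminal
  already bound the integral of a sum of step functions that dominates the distance of the rounded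
  labels. A majorant \<open>g\<close> is used so that the distance itself need not be
  integrated.\<close>

lemma round_label_distance:
  assumes p: "valid_form t A w u" and q: "valid_form s B w' u'"
    and D: "\<And>x. x \<in> T \<Longrightarrow> \<bar>normal_form t A w u x - normal_form s B w' u' x\<bar> \<le> D"
  shows "\<exists>g I. (g has_integral I) {0..1/4} \<and> I \<le> D \<and>
    (\<forall>\<alpha>. real (qdist G (round_label \<alpha> t A w u) (round_label \<alpha> s B w' u')) \<le> g \<alpha>)"
proof -
  have A: "A \<in> K" "t \<in> A" "0 \<le> w" "w \<le> u" "u \<le> 1 / 4" "A = {t} \<Longrightarrow> w = u"
    using p by (auto simp: valid_form_def)
  have B: "B \<in> K" "s \<in> B" "0 \<le> w'" "w' \<le> u'" "u' \<le> 1 / 4" "B = {s} \<Longrightarrow> w' = u'"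
    using q by (auto simp: valid_form_def)
  have T: "t \<in> T" "s \<in> T" using A B anticlique_subset by auto
  note Dt = D[OF T(1)] and Ds = D[OF T(2)]
  have int1: "(step_fun a has_integral (1 / 4 - a)) {0..1/4}" if "a \<in> {w, u, w', u'}" for a
    by (rule step_fun_integral) (use that A B in auto)
  have int2: "((\<lambda>\<alpha>. \<bar>step_fun a \<alpha> - step_fun b \<alpha>\<bar>) has_integral \<bar>a - b\<bar>) {0..1/4}"
    if "a \<in> {w, u, w', u'}" "b \<in> {w, u, w', u'}" for a b
    by (rule step_fun_diff_integral) (use that A B in auto)
  \<comment> \<open>A step at \<open>a\<close> integrates to \<open>1 / 4 - a\<close>; two of them
    give the constant 1/2.\<close>
  have three: ?thesis
    if abc: "a \<in> {w, u, w', u'}" "b \<in> {w, u, w', u'}" "c \<in> {w, u, w', u'}" "c' \<in> {w, u, w', u'}"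
      and le: "1 / 2 - a - b + \<bar>c - c'\<bar> \<le> D"
      and pt: "\<And>\<alpha>. real (qdist G (round_label \<alpha> t A w u) (round_label \<alpha> s B w' u'))
        \<le> step_fun a \<alpha> + step_fun b \<alpha> + \<bar>step_fun c \<alpha> - step_fun c' \<alpha>\<bar>" for a b c c'
    using has_integral_add[OF has_integral_add[OF int1[OF abc(1)] int1[OF abc(2)]] int2[OF abc(3,4)]] le pt
    by (intro exI conjI allI) (assumption | simp)+
  have pair: ?thesis
    if abc: "a \<in> {w, u, w', u'}" "a' \<in> {w, u, w', u'}" "c \<in> {w, u, w', u'}" "c' \<in> {w, u, w', u'}"
      and le: "\<bar>a - a'\<bar> + \<bar>c - c'\<bar> \<le> D"
      and pt: "\<And>\<alpha>. real (qdist G (round_label \<alpha> t A w u) (round_label \<alpha> s B w' u'))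
        \<le> \<bar>step_fun a \<alpha> - step_fun a' \<alpha>\<bar> + \<bar>step_fun c \<alpha> - step_fun c' \<alpha>\<bar>" for a a' c c'
    using has_integral_add[OF int2[OF abc(1,2)] int2[OF abc(3,4)]] le pt
    by (intro exI conjI allI) (assumption | simp)+
  \<comment> \<open>The relative positions of the two triangles. For distinct \<open>t\<close>,
    \<open>s\<close> and distinct \<open>A\<close>, \<open>B\<close> uniqueness excludes that both
    \<open>s \<in> A\<close> and \<open>t \<in> B\<close>.\<close>
  consider (same) "t = s" "A = B" | (petals) "t = s" "A \<noteq> B" | (inside) "t \<noteq> s" "A = B"
    | (dem) "demand s t" | (apart) "t \<noteq> s" "A \<noteq> B" "\<not> demand s t" "s \<notin> A" "t \<notin> B"
    | (left) "t \<noteq> s" "A \<noteq> B" "\<not> demand s t" "s \<in> A" "t \<notin> B"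
    | (right) "t \<noteq> s" "A \<noteq> B" "\<not> demand s t" "s \<notin> A" "t \<in> B"
    using anticlique_unique[OF A(1) B(1), of t s] A(2) B(2) by blast
  then show ?thesis
  proof cases
    case same
    have 1: "\<bar>(u + w) - (u' + w')\<bar> \<le> D" using Dt same by (simp add: normal_form_def)
    have "\<bar>u - u'\<bar> + \<bar>w - w'\<bar> \<le> D"
    proof (cases "A = {t}")
      case True
      then have "w = u" "w' = u'" using A(6) B(6) same by simp_all
      then show ?thesis using 1 by linarith
    next
      case False
      then obtain x where x: "x \<in> A" "x \<noteq> t" using A(2) by blast
      then have "x \<in> T" using anticlique_subset[OF A(1)] by blast
      from D[OF this] have "\<bar>(1 / 2 - u + w) - (1 / 2 - u' + w')\<bar> \<le> D"
        using x same by (simp add: normal_form_def)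
      then show ?thesis using 1 by linarith
    qed
    moreover have "real (qdist G (round_label \<alpha> t A w u) (round_label \<alpha> s B w' u'))
        \<le> \<bar>step_fun u \<alpha> - step_fun u' \<alpha>\<bar> + \<bar>step_fun w \<alpha> - step_fun w' \<alpha>\<bar>" for \<alpha>
      using same A(2,4) B(2,4) by (simp add: round_label_def step_fun_def)
    ultimately show ?thesis by (intro pair[of u u' w w']) simp_all
  next
    case petals
    \<comment> \<open>The triangles share the edge where \<open>u = w\<close>. Unfolding them into
      one plane reflects the second and swaps its coordinates; a terminal in \<open>A\<close> but
      not in \<open>B\<close> detects this.\<close>
    have "\<not> A \<subseteq> B" using anticlique_subset_eq[OF A(1) B(1)] petals by blast
    then obtain x where x: "x \<in> A" "x \<notin> B" by blast
    then have xt: "x \<noteq> t" "x \<noteq> s" "x \<in> T" "\<not> demand x t"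
      using petals(1) B(2) anticlique_subset[OF A(1)] not_demand[OF A(1) x(1) A(2)] by auto
    have "\<bar>(u + w) - (u' + w')\<bar> \<le> D" using Dt petals by (simp add: normal_form_def)
    moreover have "\<bar>(1 / 2 - u + w) - (1 / 2 + u' - w')\<bar> \<le> D"
      using D[OF xt(3)] x xt petals(1) by (simp add: normal_form_def)
    ultimately have "\<bar>w - u'\<bar> + \<bar>u - w'\<bar> \<le> D" by linarith
    moreover have "real (qdist G (round_label \<alpha> t A w u) (round_label \<alpha> s B w' u'))
        \<le> \<bar>step_fun w \<alpha> - step_fun u' \<alpha>\<bar> + \<bar>step_fun u \<alpha> - step_fun w' \<alpha>\<bar>" for \<alpha>
      using petals A(2,4) B(2,4) by (simp add: round_label_def step_fun_def)
    ultimately show ?thesis by (intro pair[of w u' u w']) simp_all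
  next
    case inside
    have "\<bar>(u + w) - (1 / 2 - u' + w')\<bar> \<le> D" "\<bar>(1 / 2 - u + w) - (u' + w')\<bar> \<le> D"
      using Dt Ds inside A(2) B(2) by (simp_all add: normal_form_def)
    then have "1 / 2 - u - u' + \<bar>w - w'\<bar> \<le> D" by linarith
    moreover have "real (qdist G (round_label \<alpha> t A w u) (round_label \<alpha> s B w' u'))
        \<le> step_fun u \<alpha> + step_fun u' \<alpha> + \<bar>step_fun w \<alpha> - step_fun w' \<alpha>\<bar>" for \<alpha>
      using inside A(2,4) B(2,4) not_demand[OF A(1,2), of s]
      by (simp add: round_label_def step_fun_def)
    ultimately show ?thesis by (intro three[of u u' w w']) simp_all
  next
    case dem
    then have "demand t s" by (simp add: insert_commute)
    then have ts: "t \<noteq> s" "t \<notin> B" "s \<notin> A" "demand t s"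
      using not_demand_refl not_demand[OF B(1) _ B(2)] not_demand[OF A(1,2)] by auto
    have "\<bar>(u + w) - (1 - u' - w')\<bar> \<le> D" using Dt ts by (simp add: normal_form_def)
    then have le: "1 - u - w - u' - w' \<le> D" by linarith
    have "((\<lambda>\<alpha>. step_fun u \<alpha> + step_fun w \<alpha> + (step_fun u' \<alpha> + step_fun w' \<alpha>)) has_integral
        (1 / 4 - u + (1 / 4 - w) + (1 / 4 - u' + (1 / 4 - w')))) {0..1/4}"
      by (intro has_integral_add int1) simp_all
    moreover have "real (qdist G (round_label \<alpha> t A w u) (round_label \<alpha> s B w' u'))
        \<le> step_fun u \<alpha> + step_fun w \<alpha> + (step_fun u' \<alpha> + step_fun w' \<alpha>)" for \<alpha>
      using A(2,4) B(2,4) ts by (simp add: round_label_def step_fun_def)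
    moreover have "1 / 4 - u + (1 / 4 - w) + (1 / 4 - u' + (1 / 4 - w')) \<le> D" using le by linarith
    ultimately show ?thesis by blast
  next
    case apart
    then have nd: "\<not> demand t s" by (simp add: insert_commute)
    have "\<bar>(u + w) - (1 / 2 + u' - w')\<bar> \<le> D" "\<bar>(1 / 2 + u - w) - (u' + w')\<bar> \<le> D"
      using Dt Ds apart nd by (simp_all add: normal_form_def)
    then have "1 / 2 - w - w' + \<bar>u - u'\<bar> \<le> D" by linarith
    moreover have "real (qdist G (round_label \<alpha> t A w u) (round_label \<alpha> s B w' u'))
        \<le> step_fun w \<alpha> + step_fun w' \<alpha> + \<bar>step_fun u \<alpha> - step_fun u' \<alpha>\<bar>" for \<alpha>
      using apart nd A(2,4) B(2,4) by (simp add: round_label_def step_fun_def)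
    ultimately show ?thesis by (intro three[of w w' u u']) simp_all
  next
    case left
    then have nd: "\<not> demand t s" by (simp add: insert_commute)
    have "\<bar>(u + w) - (1 / 2 + u' - w')\<bar> \<le> D" "\<bar>(1 / 2 - u + w) - (u' + w')\<bar> \<le> D"
      using Dt Ds left nd by (simp_all add: normal_form_def)
    then have "1 / 2 - u - w' + \<bar>w - u'\<bar> \<le> D" by linarith
    moreover have "real (qdist G (round_label \<alpha> t A w u) (round_label \<alpha> s B w' u'))
        \<le> step_fun u \<alpha> + step_fun w' \<alpha> + \<bar>step_fun w \<alpha> - step_fun u' \<alpha>\<bar>" for \<alpha>
      using left nd A(2,4) B(2,4) by (simp add: round_label_def step_fun_def)
    ultimately show ?thesis by (intro three[of u w' w u']) simp_all
  next
    case right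
    then have nd: "\<not> demand t s" by (simp add: insert_commute)
    have "\<bar>(u + w) - (1 / 2 - u' + w')\<bar> \<le> D" "\<bar>(1 / 2 + u - w) - (u' + w')\<bar> \<le> D"
      using Dt Ds right by (simp_all add: normal_form_def)
    then have "1 / 2 - w - u' + \<bar>u - w'\<bar> \<le> D" by linarith
    moreover have "real (qdist G (round_label \<alpha> t A w u) (round_label \<alpha> s B w' u'))
        \<le> step_fun w \<alpha> + step_fun u' \<alpha> + \<bar>step_fun u \<alpha> - step_fun w' \<alpha>\<bar>" for \<alpha>
      using right nd A(2,4) B(2,4) by (simp add: round_label_def step_fun_def)
    ultimately show ?thesis by (intro three[of w u' u w']) simp_all
  qed
qed

end

section \<open>Optimal labellings\<close>

definition simple_paths :: "('v, 'e) network \<Rightarrow> 'v \<Rightarrow> 'v \<Rightarrow> ('v list \<times> 'e list) set" where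
  "simple_paths G x v = {(vs, es).
     set vs \<subseteq> nodes G \<and> set es \<subseteq> edges G \<and> distinct vs \<and> length vs = Suc (length es) \<and>
     (\<forall>i < length es. ends G (es ! i) = {vs ! i, vs ! Suc i}) \<and> hd vs = x \<and> last vs = v}"

definition path_length :: "('v, 'e) network \<Rightarrow> ('v set \<Rightarrow> real) \<Rightarrow> 'v list \<times> 'e list \<Rightarrow> real" where
  "path_length G l p = (\<Sum>e\<leftarrow>snd p. l (ends G e))"

text \<open>Distances are capped at 1, the largest value of \<open>omega\<close>; this covers unreachable nodes.\<close>

definition capped_dist :: "('v, 'e) network \<Rightarrow> ('v set \<Rightarrow> real) \<Rightarrow> 'v \<Rightarrow> 'v \<Rightarrow> real" where
  "capped_dist G l x v = Min (insert 1 (path_length G l ` simple_paths G x v))"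

lemma finite_simple_paths:
  assumes "wf_network G"
  shows "finite (simple_paths G x v)"
proof -
  have fin: "finite (nodes G)" "finite (edges G)" using assms by (auto simp: wf_network_def)
  have "simple_paths G x v \<subseteq> {vs. set vs \<subseteq> nodes G \<and> length vs \<le> card (nodes G)}
      \<times> {es. set es \<subseteq> edges G \<and> length es \<le> card (nodes G)}"
  proof
    fix p assume "p \<in> simple_paths G x v"
    then obtain vs es where p: "p = (vs, es)" "set vs \<subseteq> nodes G" "set es \<subseteq> edges G" "distinct vs"
      "length vs = Suc (length es)"
      by (auto simp: simple_paths_def)
    then have "length vs \<le> card (nodes G)"
      using card_mono[OF fin(1) p(2)] distinct_card[OF p(4)] by simp
    then show "p \<in> {vs. set vs \<subseteq> nodes G \<and> length vs \<le> card (nodes G)}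
        \<times> {es. set es \<subseteq> edges G \<and> length es \<le> card (nodes G)}"
      using p by simp
  qed
  then show ?thesis
    using finite_lists_length_le[OF fin(1)] finite_lists_length_le[OF fin(2)]
    by (meson finite_SigmaI finite_subset)
qed

locale edge_lengths =
  fixes G :: "('v, 'e) network" and l :: "'v set \<Rightarrow> real"
  assumes wf: "wf_network G" and nonneg: "0 \<le> l q"
begin

lemma path_length_nonneg: "0 \<le> path_length G l p"
  unfolding path_length_def by (intro sum_list_nonneg) (auto simp: nonneg)

lemma finite_lengths: "finite (insert 1 (path_length G l ` simple_paths G x v))"
  using finite_simple_paths[OF wf] by simp

lemma capped_dist_le: "capped_dist G l x v \<le> 1"
  "p \<in> simple_paths G x v \<Longrightarrow> capped_dist G l x v \<le> path_length G l p"
  unfolding capped_dist_def by (intro Min_le[OF finite_lengths], simp)+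

lemma capped_dist_cases:
  obtains "capped_dist G l x v = 1"
  | p where "p \<in> simple_paths G x v" "capped_dist G l x v = path_length G l p"
proof -
  have "capped_dist G l x v \<in> insert 1 (path_length G l ` simple_paths G x v)"
    unfolding capped_dist_def by (intro Min_in finite_lengths) simp
  then show thesis using that by blast
qed

lemma capped_dist_nonneg: "0 \<le> capped_dist G l x v"
  by (rule capped_dist_cases[of x v]) (auto simp: path_length_nonneg)

lemma capped_dist_refl:
  assumes "x \<in> nodes G" shows "capped_dist G l x x = 0"
proof -
  have "([x], []) \<in> simple_paths G x x" using assms by (simp add: simple_paths_def)
  from capped_dist_le(2)[OF this] show ?thesis
    using capped_dist_nonneg[of x x] by (simp add: path_length_def)
qed

text \<open>If \<open>v\<close> already lies on a shortest path to \<open>u\<close>, the initial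
  segment up to \<open>v\<close> is no longer than the path. Otherwise the edge extends the path to
  a simple one.\<close>

lemma capped_dist_edge:
  assumes e: "e \<in> edges G" "ends G e = {u, v}"
  shows "capped_dist G l x v \<le> capped_dist G l x u + l {u, v}"
proof (rule capped_dist_cases[of x u])
  assume "capped_dist G l x u = 1"
  then show ?thesis using capped_dist_le(1)[of x v] nonneg[of "{u, v}"] by linarith
next
  fix p assume p: "p \<in> simple_paths G x u" and eq: "capped_dist G l x u = path_length G l p"
  obtain vs es where pe: "p = (vs, es)" by (cases p)
  have vs: "set vs \<subseteq> nodes G" "set es \<subseteq> edges G" "distinct vs" "length vs = Suc (length es)"
    "\<And>i. i < length es \<Longrightarrow> ends G (es ! i) = {vs ! i, vs ! Suc i}" "hd vs = x" "last vs = u"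
    using p pe by (auto simp: simple_paths_def)
  have v: "v \<in> nodes G" using wf e by (auto simp: wf_network_def)
  show ?thesis
  proof (cases "v \<in> set vs")
    case True
    then obtain k where k: "k < length vs" "vs ! k = v" by (auto simp: in_set_conv_nth)
    have "last (take (Suc k) vs) = v" using k by (simp add: take_Suc_conv_app_nth)
    moreover have "hd (take (Suc k) vs) = x" using vs(6) k by (cases vs) auto
    moreover have "set (take (Suc k) vs) \<subseteq> nodes G" "set (take k es) \<subseteq> edges G"
      using vs(1,2) set_take_subset by fast+
    ultimately have "(take (Suc k) vs, take k es) \<in> simple_paths G x v"
      using vs(3-5) k by (simp add: simple_paths_def)
    from capped_dist_le(2)[OF this]
    have "capped_dist G l x v \<le> (\<Sum>e\<leftarrow>take k es. l (ends G e))" by (simp add: path_length_def)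
    also have "\<dots> \<le> (\<Sum>e\<leftarrow>take k es. l (ends G e)) + (\<Sum>e\<leftarrow>drop k es. l (ends G e))"
      using sum_list_nonneg[of "map (\<lambda>e. l (ends G e)) (drop k es)"] nonneg by auto
    also have "\<dots> = path_length G l p"
      by (simp add: path_length_def pe flip: sum_list_append map_append)
    finally show ?thesis using eq nonneg[of "{u, v}"] by linarith
  next
    case False
    have "ends G ((es @ [e]) ! i) = {(vs @ [v]) ! i, (vs @ [v]) ! Suc i}" if "i < Suc (length es)" for i
    proof (cases "i < length es")
      case True
      then show ?thesis using vs(4,5) by (simp add: nth_append)
    next
      case False
      then have i: "i = length es" using that by simp
      have "vs ! length es = u" using vs(4,7) by (metis diff_Suc_1 last_conv_nth length_0_conv nat.distinct(1))
      then show ?thesis using i vs(4) e(2) by (simp add: nth_append)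
    qed
    moreover have "hd (vs @ [v]) = x" using vs(4,6) by (cases vs) auto
    ultimately have "(vs @ [v], es @ [e]) \<in> simple_paths G x v"
      using vs(1-4) False v e(1) by (simp add: simple_paths_def)
    from capped_dist_le(2)[OF this] show ?thesis using eq e(2) by (simp add: path_length_def pe)
  qed
qed

lemma capped_dist_triangle:
  assumes "p \<in> simple_paths G y v"
  shows "capped_dist G l x y \<le> capped_dist G l x v + path_length G l p"
proof -
  obtain vs es where p: "p = (vs, es)" by (cases p)
  \<comment> \<open>The negated distance bounds how fast the distance can decrease on the way from
    \<open>y\<close> to \<open>v\<close>.\<close>
  have "- capped_dist G l x (last vs) \<le> - capped_dist G l x (hd vs) + (\<Sum>e\<leftarrow>es. l (ends G e))"
  proof (rule walk_potential_le[where G = G])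
    fix e a b assume "e \<in> edges G" "ends G e = {a, b}"
    then show "- capped_dist G l x b \<le> - capped_dist G l x a + l {a, b}"
      using capped_dist_edge[of e b a x] by (simp add: insert_commute)
  qed (use assms p in \<open>auto simp: simple_paths_def\<close>)
  then show ?thesis using assms p by (auto simp: simple_paths_def path_length_def)
qed

lemma simple_path_in_T_paths:
  assumes "p \<in> simple_paths G s t" "s \<in> terminals G" "t \<in> terminals G" "s \<noteq> t"
  shows "p \<in> T_paths G" "end_pair p = {s, t}"
proof -
  obtain vs es where p: "p = (vs, es)" by (cases p)
  have vs: "distinct vs" "length vs = Suc (length es)"
    "\<And>i. i < length es \<Longrightarrow> ends G (es ! i) = {vs ! i, vs ! Suc i}"
    using assms(1) p by (auto simp: simple_paths_def)
  have "distinct es"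
    unfolding distinct_conv_nth
  proof (intro allI impI)
    fix i j assume ij: "i < length es" "j < length es" "i \<noteq> j"
    then have "{vs ! i, vs ! Suc i} \<noteq> {vs ! j, vs ! Suc j}"
      using vs(1,2) by (auto simp: doubleton_eq_iff nth_eq_iff_index_eq)
    then show "es ! i \<noteq> es ! j" using vs(3) ij by metis
  qed
  then show "p \<in> T_paths G" "end_pair p = {s, t}"
    using assms p by (auto simp: T_paths_def simple_paths_def end_pair_def)
qed

end

context simple_K_network
begin

lemma finite_labels: "finite (labels G)"
  using finite_T finite_K by (simp add: labels_def)

lemma normal_form_zero:
  assumes "valid_form t A w u" "normal_form t A w u x \<le> 0"
  shows "t = x" "u = 0"
proof -
  have "0 \<le> w" "w \<le> u" "u \<le> 1 / 4" using assms(1) by (auto simp: valid_form_def)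
  then show "t = x" "u = 0" using assms(2) by (auto simp: normal_form_def split: if_splits)
qed

text \<open>Every threshold gives a labelling of cost at least \<open>M\<close>, while the rounded
  ends of an edge are on average no farther apart than its length.\<close>

lemma cost_le_length:
  assumes l: "\<And>q. 0 \<le> l q"
    and long: "\<And>p. p \<in> T_paths G \<Longrightarrow> omega G (end_pair p) \<le> (\<Sum>e\<leftarrow>snd p. l (ends G e))"
    and M: "\<And>\<rho>. labelling G \<rho> \<Longrightarrow> M \<le> cost G \<rho>"
  shows "M \<le> (\<Sum>e\<in>edges G. l (ends G e))"
\<comment> \<open>Without terminals there are no normal forms, but the constant labelling costs
  0.\<close>
proof (cases "T = {}")
  case True
  have "M \<le> cost G (\<lambda>_. Centre)" by (rule M) (simp add: labelling_def labels_def True)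
  also have "cost G (\<lambda>_. Centre) = 0" by (simp add: cost_def edge_total_def)
  also have "0 \<le> (\<Sum>e\<in>edges G. l (ends G e))" by (intro sum_nonneg l)
  finally show ?thesis .
next
  case False
  interpret edge_lengths G l by unfold_locales (rule wf l)+
  \<comment> \<open>The vector of distances from all terminals. Along an edge its entries change by
    at most the length of the edge.\<close>
  define P where "P v x = capped_dist G l x v" for v x
  have far: "req x y \<le> P y x" if xy: "x \<in> T" "y \<in> T" "x \<noteq> y" for x y
  proof (rule capped_dist_cases[of x y])
    fix p assume p: "p \<in> simple_paths G x y" "capped_dist G l x y = path_length G l p"
    from simple_path_in_T_paths[OF p(1) xy] long[of p] omega_pair[OF xy] p(2) xy(3)
    show ?thesis by (simp add: P_def path_length_def split: if_splits)
  qed (simp add: P_def)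
  have adm: "admissible (P v)" for v
    unfolding admissible_def
  proof (intro conjI ballI impI)
    fix x y assume xy: "x \<in> T" "y \<in> T" "x \<noteq> y"
    show "req x y \<le> P v x + P v y"
    proof (rule capped_dist_cases[of y v])
      assume "capped_dist G l y v = 1"
      then show ?thesis using capped_dist_nonneg[of x v] by (simp add: P_def)
    next
      fix p assume p: "p \<in> simple_paths G y v" "capped_dist G l y v = path_length G l p"
      from capped_dist_triangle[OF p(1), of x] far[OF xy] p(2) show ?thesis
        unfolding P_def by linarith
    qed
  qed (simp add: P_def capped_dist_nonneg)
  obtain r where r: "\<And>p. admissible p \<Longrightarrow>
        admissible (r p) \<and> (\<forall>x\<in>T. tight (r p) x) \<and> (\<forall>x\<in>T. r p x \<le> p x)"
    and lip: "\<And>p q D. (\<forall>x\<in>T. \<bar>p x - q x\<bar> \<le> D) \<Longrightarrow> (\<forall>x\<in>T. \<bar>r p x - r q x\<bar> \<le> D)"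
    using exists_tight_retraction[OF order_refl] by blast
  have "\<forall>v. \<exists>t A w u. valid_form t A w u \<and> (\<forall>x\<in>T. r (P v) x = normal_form t A w u x)"
    using tight_normal_form[OF _ _ False] r[OF adm] by blast
  then obtain t A w u where
    valid: "\<And>v. valid_form (t v) (A v) (w v) (u v)" and
    nf: "\<And>v x. x \<in> T \<Longrightarrow> r (P v) x = normal_form (t v) (A v) (w v) (u v) x"
    by metis
  define \<rho> where "\<rho> \<alpha> v = round_label \<alpha> (t v) (A v) (w v) (u v)" for \<alpha> v
  have lab: "labelling G (\<rho> \<alpha>)" if "0 \<le> \<alpha>" for \<alpha>
    unfolding labelling_def
  proof (intro conjI ballI)
    show "\<rho> \<alpha> v \<in> labels G" for v
      using valid[of v] anticlique_subset[of "A v"]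
      by (auto simp: \<rho>_def round_label_def labels_def valid_form_def)
  next
    fix x assume x: "x \<in> T"
    then have "x \<in> nodes G" using T_subset_nodes by blast
    \<comment> \<open>The retraction does not raise the entry 0 at \<open>x\<close>, and
      \<open>At x\<close> is the only corner with value 0 there.\<close>
    then have "r (P x) x \<le> 0" using r[OF adm, of x] x capped_dist_refl by (auto simp: P_def)
    then have "t x = x" "u x = 0" using normal_form_zero[OF valid[of x], of x] nf[OF x] by simp_all
    then show "\<rho> \<alpha> x = At x" using that by (simp add: \<rho>_def round_label_def)
  qed
  have "\<exists>g I. (g has_integral I) {0..1/4} \<and> I \<le> l (ends G e) \<and>
      (\<forall>\<alpha>. (\<Sum>x\<in>ends G e. \<Sum>y\<in>ends G e. real (qdist G (\<rho> \<alpha> x) (\<rho> \<alpha> y))) / 2 \<le> g \<alpha>)"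
    if e: "e \<in> edges G" for e
  proof -
    obtain x y where xy: "x \<in> nodes G" "y \<in> nodes G" "ends G e = {x, y}"
      using wf_network_ends[OF wf e] .
    have "\<bar>P x z - P y z\<bar> \<le> l {x, y}" for z
    proof -
      have "P y z \<le> P x z + l {x, y}" "P x z \<le> P y z + l {y, x}"
        unfolding P_def using xy(3) by (intro capped_dist_edge[OF e]; simp add: insert_commute)+
      then show ?thesis by (simp add: abs_le_iff insert_commute)
    qed
    then have "\<forall>z\<in>T. \<bar>r (P x) z - r (P y) z\<bar> \<le> l {x, y}" by (intro lip) blast
    then have "\<bar>normal_form (t x) (A x) (w x) (u x) z - normal_form (t y) (A y) (w y) (u y) z\<bar> \<le> l {x, y}"
      if "z \<in> T" for z using that nf by simp
    from round_label_distance[OF valid valid this] obtain g I where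
      "(g has_integral I) {0..1/4}" "I \<le> l {x, y}"
      "\<And>\<alpha>. real (qdist G (\<rho> \<alpha> x) (\<rho> \<alpha> y)) \<le> g \<alpha>"
      unfolding \<rho>_def by blast
    moreover have "(\<Sum>a\<in>{x, y}. \<Sum>b\<in>{x, y}. real (qdist G (\<rho> \<alpha> a) (\<rho> \<alpha> b))) / 2
        = real (qdist G (\<rho> \<alpha> x) (\<rho> \<alpha> y))" for \<alpha>
      by (rule edge_sum_pair) (auto simp: qdist_sym)
    ultimately show ?thesis unfolding xy(3) by metis
  qed
  then obtain g I where g: "\<And>e. e \<in> edges G \<Longrightarrow> (g e has_integral I e) {0..1/4}"
    and I: "\<And>e. e \<in> edges G \<Longrightarrow> I e \<le> l (ends G e)"
    and le: "\<And>e \<alpha>. e \<in> edges G \<Longrightarrow>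
      (\<Sum>x\<in>ends G e. \<Sum>y\<in>ends G e. real (qdist G (\<rho> \<alpha> x) (\<rho> \<alpha> y))) / 2 \<le> g e \<alpha>"
    by metis
  \<comment> \<open>The factors agree: the threshold interval has length 1/4, and
    \<open>cost\<close> divides \<open>qdist\<close> by 4.\<close>
  have "M * (1 / 4) \<le> (\<Sum>e\<in>edges G. I e / 4)"
  proof (rule has_integral_le)
    show "((\<lambda>_ :: real. M) has_integral M * (1 / 4)) {0..1/4}"
      using has_integral_const_real[of M 0 "1 / 4"] by (simp add: mult.commute)
    show "((\<lambda>\<alpha>. \<Sum>e\<in>edges G. g e \<alpha> / 4) has_integral (\<Sum>e\<in>edges G. I e / 4)) {0..1/4}"
      by (intro has_integral_sum finite_edges has_integral_divide g)
    show "M \<le> (\<Sum>e\<in>edges G. g e \<alpha> / 4)" if "\<alpha> \<in> {0..1/4}" for \<alpha>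
    proof -
      have "M \<le> cost G (\<rho> \<alpha>)" using M lab that by simp
      also have "\<dots> = (\<Sum>e\<in>edges G.
          (\<Sum>x\<in>ends G e. \<Sum>y\<in>ends G e. real (qdist G (\<rho> \<alpha> x) (\<rho> \<alpha> y))) / 2 / 4)"
        unfolding cost_def edge_total_divide by (simp add: edge_total_def sum_divide_distrib)
      also have "\<dots> \<le> (\<Sum>e\<in>edges G. g e \<alpha> / 4)"
        by (intro sum_mono divide_right_mono le) auto
      finally show ?thesis .
    qed
  qed
  also have "\<dots> \<le> (\<Sum>e\<in>edges G. l (ends G e) / 4)"
    by (intro sum_mono divide_right_mono I) auto
  finally show ?thesis by (simp add: sum_divide_distrib[symmetric])
qed

lemma labelling_exists: "labelling G (\<lambda>v. if v \<in> T then At v else Centre)"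
  by (auto simp: labelling_def labels_def)

text \<open>Labellings are functions on the whole type, but only their values on the nodes affect
  the cost, so there are finitely many costs.\<close>

lemma optimal_labelling_exists: "\<exists>\<rho>. labelling G \<rho> \<and> (\<forall>\<sigma>. labelling G \<sigma> \<longrightarrow> cost G \<rho> \<le> cost G \<sigma>)"
proof -
  have "{cost G \<rho> |\<rho>. labelling G \<rho>} \<subseteq> cost G ` (nodes G \<rightarrow>\<^sub>E labels G)"
  proof
    fix c assume "c \<in> {cost G \<rho> |\<rho>. labelling G \<rho>}"
    then obtain \<rho> where \<rho>: "c = cost G \<rho>" "labelling G \<rho>" by blast
    have "cost G \<rho> = cost G (restrict \<rho> (nodes G))"
      unfolding cost_def by (rule edge_total_cong[OF wf]) simp
    moreover have "restrict \<rho> (nodes G) \<in> nodes G \<rightarrow>\<^sub>E labels G"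
      using \<rho>(2) by (simp add: labelling_def)
    ultimately show "c \<in> cost G ` (nodes G \<rightarrow>\<^sub>E labels G)" using \<rho>(1) by blast
  qed
  then have fin: "finite {cost G \<rho> |\<rho>. labelling G \<rho>}"
    using finite_PiE[OF finite_nodes, of "\<lambda>_. labels G"] finite_labels finite_subset by blast
  have "Min {cost G \<rho> |\<rho>. labelling G \<rho>} \<in> {cost G \<rho> |\<rho>. labelling G \<rho>}"
    using labelling_exists by (intro Min_in fin) blast
  then obtain \<rho> where "labelling G \<rho>" "cost G \<rho> = Min {cost G \<rho> |\<rho>. labelling G \<rho>}" by force
  moreover have "Min {cost G \<rho> |\<rho>. labelling G \<rho>} \<le> cost G \<sigma>" if "labelling G \<sigma>" for \<sigma>
    using that by (intro Min_le[OF fin]) blast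
  ultimately show ?thesis by (intro exI[of _ \<rho>]) simp
qed

lemma strong_duality:
  "\<exists>f \<rho>. multiflow G f \<and> labelling G \<rho> \<and> Theta G f = cost G \<rho>"
proof -
  obtain \<rho> where \<rho>: "labelling G \<rho>" "\<And>\<sigma>. labelling G \<sigma> \<Longrightarrow> cost G \<rho> \<le> cost G \<sigma>"
    using optimal_labelling_exists by blast
  have "\<exists>f. multiflow G f \<and> cost G \<rho> \<le> Theta G f"
    by (rule exists_multiflow_ge[OF wf]) (rule cost_le_length[OF _ _ \<rho>(2)])
  then show ?thesis using Theta_le_cost[OF _ \<rho>(1)] \<rho>(1) by (meson order_antisym)
qed

lemma theta_eq_cost:
  assumes "multiflow G f" "labelling G \<rho>" "Theta G f = cost G \<rho>"
  shows "theta G = Theta G f"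
  unfolding theta_def
proof (rule cSup_eq_maximum)
  show "Theta G f \<in> Theta G ` {f. multiflow G f}" using assms(1) by blast
  show "x \<le> Theta G f" if "x \<in> Theta G ` {f. multiflow G f}" for x
    using that Theta_le_cost[OF _ assms(2)] assms(3) by auto
qed

lemma theta_le_cost:
  assumes "labelling G \<rho>" shows "theta G \<le> cost G \<rho>"
  using strong_duality theta_eq_cost Theta_le_cost[OF _ assms] by metis

lemma theta_attained: "\<exists>f. multiflow G f \<and> Theta G f = theta G"
  using strong_duality theta_eq_cost by metis

lemma theta_labelling: "\<exists>\<rho>. labelling G \<rho> \<and> cost G \<rho> = theta G"
  using strong_duality theta_eq_cost by metis

lemma Theta_le_theta: "multiflow G f \<Longrightarrow> Theta G f \<le> theta G"
  using theta_labelling Theta_le_cost by metis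

end

section \<open>Upper bound from minimum cuts\<close>

text \<open>\<open>dual_value\<close> with each \<open>X t\<close> reduced to the node
  \<open>t\<close>, as is the case after contraction.\<close>

definition cut_bound :: "('v, 'e) network \<Rightarrow> real" where
  "cut_bound G = (\<Sum>t\<in>terminals G. real (cut G {t})) / 2 - (\<Sum>A\<in>anticliques G. beta G A) / 2"

text \<open>Layer-cake count: each level from 2 on that lies between the two counts contributes 1.
  The truncated subtractions discard the levels below 2.\<close>

lemma sum_threshold_le:
  "(\<Sum>k\<in>{2..a::nat}. if (k < m) = (k < n) then 0 else 1) \<le> \<bar>real (m - 2) - real (n - 2)\<bar>"
proof -
  have *: "(\<Sum>k\<in>{2..a}. if (k < m) = (k < n) then 0 else 1) \<le> \<bar>real (m - 2) - real (n - 2)\<bar>"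
    if "m \<le> n" for m n :: nat
  proof -
    have "(\<Sum>k\<in>{2..a}. if (k < m) = (k < n) then 0 else 1 :: real)
        = real (card ({2..a} \<inter> {k. (k < m) \<noteq> (k < n)}))"
      by (subst sum.If_cases) (auto simp: Compl_eq)
    also have "\<dots> \<le> real (card {max 2 m..<n})"
      using that by (intro of_nat_mono card_mono) auto
    also have "\<dots> \<le> \<bar>real (m - 2) - real (n - 2)\<bar>" using that by simp
    finally show ?thesis .
  qed
  show ?thesis
  proof (cases "m \<le> n")
    case False
    have eq: "((k < m) = (k < n)) = ((k < n) = (k < m))" for k by blast
    show ?thesis using *[of n m] False by (subst eq) (simp add: abs_minus_commute)
  qed (rule *)
qed

lemma card_diff_add_card_diff:
  assumes "finite A" "finite B"
  shows "real (card (A - B) + card (B - A)) = real (card A) + real (card B) - 2 * real (card (A \<inter> B))"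
proof -
  have "card (A - B) + card (A \<inter> B) = card A" "card (B - A) + card (A \<inter> B) = card B"
    using assms card_Int_Diff[of A B] card_Int_Diff[of B A] by (simp_all add: Int_commute)
  then show ?thesis by linarith
qed

lemma sum_membership:
  assumes "finite I"
  shows "(\<Sum>i\<in>I. if P i = Q i then 0 else 1)
    = real (card ({i\<in>I. P i} - {i\<in>I. Q i}) + card ({i\<in>I. Q i} - {i\<in>I. P i}))"
proof -
  have "(\<Sum>i\<in>I. if P i = Q i then 0 else 1)
      = real (card (({i\<in>I. P i} - {i\<in>I. Q i}) \<union> ({i\<in>I. Q i} - {i\<in>I. P i})))"
    using assms by (subst sum.If_cases) (auto intro!: arg_cong[of _ _ card])
  also have "\<dots> = real (card ({i\<in>I. P i} - {i\<in>I. Q i}) + card ({i\<in>I. Q i} - {i\<in>I. P i}))"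
    using assms by (subst card_Un_disjoint) auto
  finally show ?thesis .
qed

context simple_K_network
begin

abbreviation petal_count :: "'v \<Rightarrow> nat" where "petal_count t \<equiv> card {A \<in> K. t \<in> A}"

lemma petal_count_pos:
  assumes "t \<in> T" shows "1 \<le> petal_count t"
proof -
  obtain A where "A \<in> K" "t \<in> A" using anticlique_pair[OF assms assms not_demand_refl] by blast
  then have "{A \<in> K. t \<in> A} \<noteq> {}" by blast
  then show ?thesis using finite_K by (simp add: Suc_le_eq card_gt_0_iff)
qed

lemma sum_anticliques_swap: "(\<Sum>A\<in>K. \<Sum>t\<in>A. g t) = (\<Sum>t\<in>T. real (petal_count t) * g t)"
proof -
  have "(\<Sum>A\<in>K. \<Sum>t\<in>A. g t) = (\<Sum>A\<in>K. \<Sum>t\<in>{t\<in>T. t \<in> A}. g t)"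
    using anticlique_subset by (intro sum.cong refl) blast
  also have "\<dots> = (\<Sum>t\<in>T. \<Sum>A\<in>{A\<in>K. t \<in> A}. g t)"
    by (rule sum.swap_restrict[OF finite_K finite_T])
  finally show ?thesis by simp
qed

lemma cut_bound_expand:
  "4 * cut_bound G = 2 * (\<Sum>t\<in>T. real (cut G {t}))
    - (\<Sum>t\<in>T. real (petal_count t) * real (lambda G {t})) + (\<Sum>A\<in>K. real (lambda G A))"
proof -
  have "(\<Sum>A\<in>K. beta G A) = ((\<Sum>A\<in>K. \<Sum>t\<in>A. real (lambda G {t})) - (\<Sum>A\<in>K. real (lambda G A))) / 2"
    by (simp add: beta_def sum_divide_distrib[symmetric] sum_subtractf)
  then show ?thesis by (simp add: cut_bound_def sum_anticliques_swap field_simps)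
qed

section \<open>Uncrossing minimum cuts\<close>

lemma minimal_cut_exists:
  assumes "B \<subseteq> T"
  shows "\<exists>Z. Z \<subseteq> nodes G \<and> Z \<inter> T = B \<and> cut G Z = lambda G B \<and>
    (\<forall>Z'. Z' \<subseteq> nodes G \<and> Z' \<inter> T = B \<and> cut G Z' = lambda G B \<longrightarrow> card Z \<le> card Z')"
proof -
  let ?P = "\<lambda>Z. Z \<subseteq> nodes G \<and> Z \<inter> T = B \<and> cut G Z = lambda G B"
  obtain Z0 where "?P Z0" using lambda_attained[OF wf assms] by blast
  from ex_has_least_nat[of ?P, OF this, of card] show ?thesis by blast
qed

text \<open>Least cardinality is demanded so that uncrossing yields disjointness and inclusion of
  the sets themselves.\<close>

definition min_cut :: "'v set \<Rightarrow> 'v set" where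
  "min_cut B = (SOME Z. Z \<subseteq> nodes G \<and> Z \<inter> T = B \<and> cut G Z = lambda G B \<and>
    (\<forall>Z'. Z' \<subseteq> nodes G \<and> Z' \<inter> T = B \<and> cut G Z' = lambda G B \<longrightarrow> card Z \<le> card Z'))"

lemma min_cut:
  assumes "B \<subseteq> T"
  shows "min_cut B \<subseteq> nodes G" "min_cut B \<inter> T = B" "cut G (min_cut B) = lambda G B"
    "Z \<subseteq> nodes G \<Longrightarrow> Z \<inter> T = B \<Longrightarrow> cut G Z \<le> lambda G B \<Longrightarrow> card (min_cut B) \<le> card Z"
proof -
  note * = someI_ex[OF minimal_cut_exists[OF assms], folded min_cut_def]
  show "min_cut B \<subseteq> nodes G" "min_cut B \<inter> T = B" "cut G (min_cut B) = lambda G B" using * by blast+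
  assume Z: "Z \<subseteq> nodes G" "Z \<inter> T = B" "cut G Z \<le> lambda G B"
  then have "cut G Z = lambda G B" using lambda_le_cut[OF wf Z(1)] by simp
  then show "card (min_cut B) \<le> card Z" using * Z by blast
qed

text \<open>By posimodularity both differences are minimum cuts again, and least cardinality leaves
  nothing to remove.\<close>

lemma min_cut_disjoint:
  assumes "A \<subseteq> T" "B \<subseteq> T" "A \<inter> B = {}"
  shows "min_cut A \<inter> min_cut B = {}"
proof -
  let ?X = "min_cut A" and ?Y = "min_cut B"
  have X: "?X - ?Y \<subseteq> nodes G" "(?X - ?Y) \<inter> T = A" and Y: "?Y - ?X \<subseteq> nodes G" "(?Y - ?X) \<inter> T = B"
    using min_cut(1,2)[OF assms(1)] min_cut(1,2)[OF assms(2)] assms(3) by auto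
  have "cut G (?X - ?Y) \<le> lambda G A"
    using cut_posimodular[OF wf, of ?X ?Y] lambda_le_cut[OF wf Y(1)] Y(2)
      min_cut(3)[OF assms(1)] min_cut(3)[OF assms(2)] by simp
  then have "card ?X \<le> card (?X - ?Y)" by (rule min_cut(4)[OF assms(1) X])
  moreover have "finite ?X" using min_cut(1)[OF assms(1)] finite_nodes finite_subset by blast
  ultimately have "?X - ?Y = ?X" by (intro card_subset_eq) (auto intro: antisym card_mono)
  then show ?thesis by blast
qed

text \<open>By submodularity the intersection is a minimum cut for \<open>A\<close>, and least
  cardinality makes it all of \<open>min_cut A\<close>.\<close>

lemma min_cut_mono:
  assumes "A \<subseteq> B" "B \<subseteq> T"
  shows "min_cut A \<subseteq> min_cut B"
proof -
  have "A \<subseteq> T" using assms by blast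
  note A = min_cut[OF this] and B = min_cut[OF assms(2)]
  let ?X = "min_cut A" and ?Y = "min_cut B"
  have X: "?X \<inter> ?Y \<subseteq> nodes G" "(?X \<inter> ?Y) \<inter> T = A" and Y: "?X \<union> ?Y \<subseteq> nodes G" "(?X \<union> ?Y) \<inter> T = B"
    using A(1,2) B(1,2) assms(1) by auto
  have "cut G (?X \<inter> ?Y) \<le> lambda G A"
    using cut_submodular[OF wf, of ?X ?Y] lambda_le_cut[OF wf Y(1)] Y(2) A(3) B(3) by simp
  then have "card ?X \<le> card (?X \<inter> ?Y)" by (rule A(4)[OF X])
  moreover have "finite ?X" using A(1) finite_nodes finite_subset by blast
  ultimately have "?X \<inter> ?Y = ?X" by (intro card_subset_eq) (auto intro: antisym card_mono)
  then show ?thesis by blast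
qed

text \<open>Every anticlique, and next to them every single terminal once more. The tag keeps an anticlique
  that consists of one terminal apart from that terminal.\<close>

definition cut_index :: "('v set \<times> bool) set" where
  "cut_index = K \<times> {True} \<union> (\<lambda>t. ({t}, False)) ` T"

lemma finite_cut_index: "finite cut_index"
  using finite_K finite_T by (simp add: cut_index_def)

lemma cut_index_subset: "i \<in> cut_index \<Longrightarrow> fst i \<subseteq> T"
  using anticlique_subset[of "fst i"] by (auto simp: cut_index_def)

lemma cut_index_unique:
  assumes "i \<in> cut_index" "j \<in> cut_index" "s \<in> fst i" "t \<in> fst i" "s \<in> fst j" "t \<in> fst j" "s \<noteq> t"
  shows "i = j"
  using assms anticlique_unique[of "fst i" "fst j" s t] by (auto simp: cut_index_def)

lemma card_index_pair:
  assumes "s \<noteq> t" "S \<subseteq> {i \<in> cut_index. s \<in> fst i \<and> t \<in> fst i}"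
  shows "card S \<le> 1"
proof -
  have fin: "finite S" using assms(2) finite_cut_index finite_subset by fastforce
  show ?thesis using assms cut_index_unique
    by (subst One_nat_def, subst card_le_Suc0_iff_eq[OF fin]) blast
qed

lemma sum_cut_index: "(\<Sum>i\<in>cut_index. g (fst i)) = (\<Sum>A\<in>K. g A) + (\<Sum>t\<in>T. g {t})"
proof -
  have "(\<Sum>i\<in>cut_index. g (fst i)) = (\<Sum>i\<in>K \<times> {True}. g (fst i)) + (\<Sum>i\<in>(\<lambda>t. ({t}, False)) ` T. g (fst i))"
    unfolding cut_index_def using finite_K finite_T by (intro sum.union_disjoint) auto
  also have "K \<times> {True} = (\<lambda>A. (A, True)) ` K" by auto
  finally show ?thesis by (simp add: sum.reindex inj_on_def)
qed

lemma card_terminal_index: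
  assumes "t \<in> T" shows "card {i \<in> cut_index. t \<in> fst i} = Suc (petal_count t)"
proof -
  have "{i \<in> cut_index. t \<in> fst i} = insert ({t}, False) ((\<lambda>A. (A, True)) ` {A \<in> K. t \<in> A})"
    using assms by (auto simp: cut_index_def)
  also have "card \<dots> = Suc (card ((\<lambda>A. (A, True)) ` {A \<in> K. t \<in> A}))"
    using finite_K by (subst card_insert_disjoint) auto
  also have "card ((\<lambda>A. (A, True)) ` {A \<in> K. t \<in> A}) = petal_count t"
    by (rule card_image) (simp add: inj_on_def)
  finally show ?thesis .
qed

section \<open>Labels read off from the cuts through a node\<close>

definition cuts_at :: "'v \<Rightarrow> ('v set \<times> bool) set" where
  "cuts_at v = {i \<in> cut_index. v \<in> min_cut (fst i)}"

lemma finite_cuts_at: "finite (cuts_at v)"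
  using finite_cut_index by (simp add: cuts_at_def)

lemma cuts_at_terminal:
  assumes "t \<in> T" shows "cuts_at t = {i \<in> cut_index. t \<in> fst i}"
  using min_cut(2)[OF cut_index_subset] assms by (auto simp: cuts_at_def)

lemma cuts_at_intersect:
  assumes "i \<in> cuts_at v" "j \<in> cuts_at v"
  shows "fst i \<inter> fst j \<noteq> {}"
  using assms min_cut_disjoint[OF cut_index_subset cut_index_subset, of i j] by (auto simp: cuts_at_def)

text \<open>A Helly property: the index sets of cuts through one node meet pairwise, and the
  anticlique condition turns this into a common terminal.\<close>

lemma cuts_at_cases:
  obtains (none) "cuts_at v = {}"
  | (one) A where "A \<in> K" "cuts_at v = {(A, True)}"
  | (many) t where "t \<in> T" "2 \<le> card (cuts_at v)" "\<And>i. i \<in> cuts_at v \<Longrightarrow> t \<in> fst i"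
proof (cases "cuts_at v = {}")
  case False
  have index: "i \<in> cut_index" if "i \<in> cuts_at v" for i using that by (simp add: cuts_at_def)
  show thesis
  proof (cases "card (cuts_at v) = 1")
    case True
    then obtain i where i: "cuts_at v = {i}" by (auto simp: card_1_singleton_iff)
    then have "i \<in> cuts_at v" by simp
    then have ii: "i \<in> cut_index" "v \<in> min_cut (fst i)" by (simp_all add: cuts_at_def)
    show thesis
    proof (cases "snd i")
      case True
      then have "i = (fst i, True)" by (cases i) simp
      moreover have "fst i \<in> K" using True ii(1) by (auto simp: cut_index_def)
      ultimately show thesis using one[of "fst i"] i by simp
    next
      case False
      then obtain t where t: "i = ({t}, False)" "t \<in> T" using ii(1) by (auto simp: cut_index_def)
      obtain A where A: "A \<in> K" "t \<in> A" using anticlique_pair[OF t(2) t(2) not_demand_refl] by blast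
      \<comment> \<open>Cuts are nested, so the cut of a single terminal is never the only one
        through a node.\<close>
      then have "min_cut {t} \<subseteq> min_cut A" using anticlique_subset by (intro min_cut_mono) auto
      then have "(A, True) \<in> cuts_at v" using ii(2) t A by (auto simp: cuts_at_def cut_index_def)
      then show thesis using i t by simp
    qed
  next
    case ne1: False
    then have two: "2 \<le> card (cuts_at v)"
      using False finite_cuts_at[of v] card_gt_0_iff[of "cuts_at v"] by linarith
    then obtain i j where ij: "i \<in> cuts_at v" "j \<in> cuts_at v" "i \<noteq> j"
      using card_le_Suc0_iff_eq[OF finite_cuts_at[of v]] by force
    obtain t where t: "t \<in> fst i" "t \<in> fst j" using cuts_at_intersect[OF ij(1,2)] by blast
    have tT: "t \<in> T" using t cut_index_subset[OF index[OF ij(1)]] by blast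
    have "t \<in> fst k" if k: "k \<in> cuts_at v" for k
    proof (rule ccontr)
      assume no: "t \<notin> fst k"
      obtain x y where x: "x \<in> fst i" "x \<in> fst k" and y: "y \<in> fst j" "y \<in> fst k"
        using cuts_at_intersect[OF ij(1) k] cuts_at_intersect[OF ij(2) k] by blast
      have xt: "x \<noteq> t" and yt: "y \<noteq> t" using x y no by auto
      have xj: "x \<notin> fst j" using cut_index_unique[OF index[OF ij(1)] index[OF ij(2)], of x t] x t xt ij(3) by blast
      then have xy: "x \<noteq> y" using y by blast
      have *: "fst n \<in> K" if "n \<in> cut_index" "a \<in> fst n" "b \<in> fst n" "a \<noteq> b" for n a b
        using that by (auto simp: cut_index_def)
      have K: "fst i \<in> K" "fst j \<in> K" "fst k \<in> K"
        using *[OF index[OF ij(1)] x(1) t(1) xt] *[OF index[OF ij(2)] y(1) t(2) yt] *[OF index[OF k] x(2) y(2) xy] .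
      have "fst i \<noteq> fst j" "fst i \<noteq> fst k" "fst j \<noteq> fst k" using x xj t no by auto
      from flower[OF K this] have "fst i \<inter> fst j = fst i \<inter> fst k" using t x y by blast
      then show False using t no by blast
    qed
    then show thesis using many[OF tT two] by blast
  qed
qed (rule none)

text \<open>The chosen terminal is unique: in the last case there are two different indices, and
  these share at most one terminal.\<close>

definition cut_label :: "'v \<Rightarrow> 'v label" where
  "cut_label v = (if cuts_at v = {} then Centre
     else if \<exists>A. cuts_at v = {(A, True)} then Mid (THE A. cuts_at v = {(A, True)})
     else At (SOME t. t \<in> T \<and> (\<forall>i\<in>cuts_at v. t \<in> fst i)))"

lemma cut_label_cases:
  obtains (none) "cut_label v = Centre" "cuts_at v = {}"
  | (one) A where "cut_label v = Mid A" "A \<in> K" "cuts_at v = {(A, True)}"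
  | (many) t where "cut_label v = At t" "t \<in> T" "2 \<le> card (cuts_at v)" "\<And>i. i \<in> cuts_at v \<Longrightarrow> t \<in> fst i"
proof (rule cuts_at_cases[of v])
  assume "cuts_at v = {}"
  then show thesis using none by (simp add: cut_label_def)
next
  fix A assume "A \<in> K" "cuts_at v = {(A, True)}"
  then show thesis using one[of A] by (simp add: cut_label_def)
next
  fix t assume t: "t \<in> T" "2 \<le> card (cuts_at v)" "\<And>i. i \<in> cuts_at v \<Longrightarrow> t \<in> fst i"
  let ?P = "\<lambda>t. t \<in> T \<and> (\<forall>i\<in>cuts_at v. t \<in> fst i)"
  have ne: "cuts_at v \<noteq> {}" "\<not> (\<exists>A. cuts_at v = {(A, True)})" using t(2) by force+
  have "cut_label v = At (Eps ?P)"
    unfolding cut_label_def if_not_P[OF ne(1)] if_not_P[OF ne(2)] ..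
  moreover have "?P t" using t by blast
  then have "?P (Eps ?P)" by (rule someI)
  ultimately show thesis using many[OF _ _ t(2)] by blast
qed

lemma labelling_cut_label: "labelling G cut_label"
  unfolding labelling_def
proof (intro conjI ballI)
  show "cut_label v \<in> labels G" for v
    by (rule cut_label_cases[of v]) (auto simp: labels_def)
next
  fix t assume t: "t \<in> T"
  have c: "2 \<le> card (cuts_at t)"
    using card_terminal_index[OF t] petal_count_pos[OF t] cuts_at_terminal[OF t] by simp
  show "cut_label t = At t"
  proof (rule cut_label_cases[of t])
    fix s assume s: "cut_label t = At s" "\<And>i. i \<in> cuts_at t \<Longrightarrow> s \<in> fst i"
    have "({t}, False) \<in> cuts_at t" unfolding cuts_at_terminal[OF t] using t by (simp add: cut_index_def)
    then show ?thesis using s by fastforce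
  qed (use c in auto)
qed

text \<open>The cuts around \<open>t\<close> beyond the two that the label \<open>At t\<close>
  accounts for. At nodes with another label at most one cut is around \<open>t\<close>, so truncated
  subtraction gives 0.\<close>

definition excess :: "'v \<Rightarrow> 'v \<Rightarrow> nat" where
  "excess t v = card {i \<in> cuts_at v. t \<in> fst i} - 2"

lemma excess_eq:
  assumes "t \<in> T"
  shows "excess t v = (if cut_label v = At t then card (cuts_at v) - 2 else 0)"
proof (rule cut_label_cases[of v])
  assume "cut_label v = Centre" "cuts_at v = {}"
  then show ?thesis by (simp add: excess_def)
next
  fix A assume A: "cut_label v = Mid A" "cuts_at v = {(A, True)}"
  have "card {i \<in> cuts_at v. t \<in> fst i} \<le> card (cuts_at v)" by (intro card_mono finite_cuts_at) auto
  then show ?thesis using A by (simp add: excess_def)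
next
  fix s assume s: "cut_label v = At s" "\<And>i. i \<in> cuts_at v \<Longrightarrow> s \<in> fst i"
  show ?thesis
  proof (cases "s = t")
    case True
    then have "{i \<in> cuts_at v. t \<in> fst i} = cuts_at v" using s(2) by blast
    then show ?thesis using s True by (simp add: excess_def)
  next
    case False
    have "card {i \<in> cuts_at v. t \<in> fst i} \<le> 1"
      by (rule card_index_pair[OF False]) (use s(2) in \<open>auto simp: cuts_at_def\<close>)
    then show ?thesis using s False by (simp add: excess_def)
  qed
qed

lemma sum_excess_at:
  assumes "cut_label v = At t" "t \<in> T"
  shows "(\<Sum>s\<in>T. real (excess s v)) = real (card (cuts_at v) - 2)"
proof -
  have "(\<Sum>s\<in>T. real (excess s v)) = (\<Sum>s\<in>T. if t = s then real (card (cuts_at v) - 2) else 0)"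
    using assms by (intro sum.cong) (auto simp: excess_eq)
  then show ?thesis using assms(2) finite_T by simp
qed

lemma sum_excess_not_at:
  assumes "\<And>t. cut_label v \<noteq> At t"
  shows "(\<Sum>s\<in>T. real (excess s v)) = 0"
  using assms by (intro sum.neutral) (simp add: excess_eq)

text \<open>A node lies in as many cuts as the rank of its label (2, 1, 0 for \<open>At\<close>,
  \<open>Mid\<close>, \<open>Centre\<close>) plus its excess. Hence the symmetric difference pays
  for distance and excess together. For two nodes with the same terminal as label only the excess
  differs.\<close>

lemma qdist_cut_label_add_excess_le:
  "real (qdist G (cut_label x) (cut_label y)) + (\<Sum>t\<in>T. \<bar>real (excess t x) - real (excess t y)\<bar>)
    \<le> real (card (cuts_at x - cuts_at y) + card (cuts_at y - cuts_at x))" (is "?d x y + ?s x y \<le> ?c x y")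
proof -
  note diff = card_diff_add_card_diff[OF finite_cuts_at finite_cuts_at]
  have tri: "?s x y \<le> (\<Sum>t\<in>T. real (excess t x)) + (\<Sum>t\<in>T. real (excess t y))" for x y
    unfolding sum.distrib[symmetric] by (intro sum_mono) linarith
  have sym: "?d x y = ?d y x" "?s x y = ?s y x" "?c x y = ?c y x" for x y
    by (simp_all add: qdist_sym abs_minus_commute add.commute)
  have at: "?d x y + ?s x y \<le> ?c x y"
    if x: "cut_label x = At s" "s \<in> T" "2 \<le> card (cuts_at x)" "\<And>i. i \<in> cuts_at x \<Longrightarrow> s \<in> fst i" for x y s
  proof (rule cut_label_cases[of y])
    assume y: "cut_label y = Centre" "cuts_at y = {}"
    show ?thesis using tri[of x y] sum_excess_at[OF x(1,2)] sum_excess_not_at[of y] x y by simp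
  next
    fix A assume y: "cut_label y = Mid A" "A \<in> K" "cuts_at y = {(A, True)}"
    have "real (qdist G (At s) (Mid A)) \<le> 3 - 2 * real (card (cuts_at x \<inter> {(A, True)}))"
      using x(4)[of "(A, True)"] by (cases "(A, True) \<in> cuts_at x") auto
    then show ?thesis
      using tri[of x y] sum_excess_at[OF x(1,2)] sum_excess_not_at[of y] x y
      unfolding diff[of x y] by simp
  next
    fix t assume y: "cut_label y = At t" "t \<in> T" "2 \<le> card (cuts_at y)" "\<And>i. i \<in> cuts_at y \<Longrightarrow> t \<in> fst i"
    show ?thesis
    proof (cases "s = t")
      case True
      have "?s x y = (\<Sum>r\<in>T. if t = r then \<bar>real (card (cuts_at x) - 2) - real (card (cuts_at y) - 2)\<bar> else 0)"
        using x(1) y(1) True by (intro sum.cong) (auto simp: excess_eq)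
      also have "\<dots> = \<bar>real (card (cuts_at x)) - real (card (cuts_at y))\<bar>"
        using y(2) finite_T x(3) y(3) by simp
      also have "\<dots> \<le> ?c x y"
        using card_mono[OF finite_cuts_at[of x], of "cuts_at x \<inter> cuts_at y"]
          card_mono[OF finite_cuts_at[of y], of "cuts_at x \<inter> cuts_at y"]
        unfolding diff[of x y] by simp
      finally show ?thesis using x(1) y(1) True by simp
    next
      case False
      have c: "card (cuts_at x \<inter> cuts_at y) \<le> 1"
        by (rule card_index_pair[OF False]) (use x(4) y(4) in \<open>auto simp: cuts_at_def\<close>)
      \<comment> \<open>A shared cut belongs to an anticlique with both terminals, so the distance
        drops from 4 to 2.\<close>
      have "real (qdist G (At s) (At t)) \<le> 4 - 2 * real (card (cuts_at x \<inter> cuts_at y))"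
      proof (cases "cuts_at x \<inter> cuts_at y = {}")
        case True
        then show ?thesis by simp
      next
        case ne: False
        then obtain i where "i \<in> cuts_at x" "i \<in> cuts_at y" by blast
        then have i: "i \<in> cut_index" "s \<in> fst i" "t \<in> fst i"
          using x(4) y(4) by (simp_all add: cuts_at_def)
        then have "fst i \<in> K" using False by (auto simp: cut_index_def)
        then have "\<not> demand s t" using not_demand i by blast
        then show ?thesis using c by simp
      qed
      then show ?thesis
        using tri[of x y] sum_excess_at[OF x(1,2)] sum_excess_at[OF y(1,2)] x y
        unfolding diff[of x y] by simp
    qed
  qed
  show ?thesis
  proof (cases "(\<exists>t. cut_label x = At t) \<or> (\<exists>t. cut_label y = At t)")
    case True
    then consider t where "cut_label x = At t" | t where "cut_label y = At t" by blast
    then show ?thesis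
    proof cases
      case 1
      then show ?thesis using at[of x _ y] by (rule_tac cut_label_cases[of x]) simp_all
    next
      case 2
      then show ?thesis using at[of y _ x] unfolding sym[of x y]
        by (rule_tac cut_label_cases[of y]) simp_all
    qed
  next
    case False
    have "?s x y \<le> 0" using tri[of x y] sum_excess_not_at[of x] sum_excess_not_at[of y] False by simp
    moreover have "?d x y \<le> ?c x y"
      by (rule cut_label_cases[of x]; rule cut_label_cases[of y]) (use False in auto)
    ultimately show ?thesis by linarith
  qed
qed

text \<open>For a terminal in more than two anticliques \<open>lambda G {t}\<close> occurs in \<open>cut_bound\<close> with a negative
  coefficient. It is absorbed by the cuts of the level sets \<open>L t k\<close>, which contain no terminal but \<open>t\<close>.\<close>

lemma cost_cut_label_le: "cost G cut_label \<le> cut_bound G"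
proof -
  \<comment> \<open>Levels start at 2 because the label accounts for two cuts. They end at
    \<open>petal_count t\<close> because \<open>t\<close> lies in one cut more than that, its own,
    and so stays in the level set.\<close>
  define L where "L t k = {v \<in> nodes G. k < card {i \<in> cuts_at v. t \<in> fst i}}" for t k
  have L: "lambda G {t} \<le> cut G (L t k)" if t: "t \<in> T" and k: "k \<in> {2..petal_count t}" for t k
  proof -
    have "L t k \<inter> T = {t}"
    proof (intro equalityI subsetI)
      fix s assume s: "s \<in> L t k \<inter> T"
      show "s \<in> {t}"
      proof (rule ccontr)
        assume "s \<notin> {t}"
        then have "card {i \<in> cuts_at s. t \<in> fst i} \<le> 1"
          using s by (intro card_index_pair[of s t]) (auto simp: cuts_at_terminal)
        then show False using s k by (simp add: L_def)
      qed
    next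
      fix s assume "s \<in> {t}"
      moreover have "{i \<in> cuts_at t. t \<in> fst i} = {i \<in> cut_index. t \<in> fst i}"
        using cuts_at_terminal[OF t] by blast
      ultimately show "s \<in> L t k \<inter> T"
        using t k T_subset_nodes card_terminal_index[OF t] by (auto simp: L_def)
    qed
    then show ?thesis using lambda_le_cut[OF wf, of "L t k"] by (simp add: L_def)
  qed
  have "4 * cost G cut_label = edge_total G (\<lambda>x y. real (qdist G (cut_label x) (cut_label y)))"
    unfolding cost_def edge_total_divide by simp
  also have "\<dots> \<le> edge_total G (\<lambda>x y. (\<Sum>i\<in>cut_index. separates (min_cut (fst i)) x y)
      - (\<Sum>t\<in>T. \<Sum>k\<in>{2..petal_count t}. separates (L t k) x y))"
  proof (rule edge_total_mono[OF wf])
    fix x y assume xy: "x \<in> nodes G" "y \<in> nodes G"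
    have "(\<Sum>i\<in>cut_index. separates (min_cut (fst i)) x y)
        = real (card (cuts_at x - cuts_at y) + card (cuts_at y - cuts_at x))"
      unfolding separates_def cuts_at_def by (rule sum_membership[OF finite_cut_index])
    moreover have "(\<Sum>k\<in>{2..petal_count t}. separates (L t k) x y)
        \<le> \<bar>real (excess t x) - real (excess t y)\<bar>" for t
      using sum_threshold_le[where a = "petal_count t" and m = "card {i \<in> cuts_at x. t \<in> fst i}"
          and n = "card {i \<in> cuts_at y. t \<in> fst i}"] xy
      by (simp add: excess_def separates_def L_def)
    then have "(\<Sum>t\<in>T. \<Sum>k\<in>{2..petal_count t}. separates (L t k) x y)
        \<le> (\<Sum>t\<in>T. \<bar>real (excess t x) - real (excess t y)\<bar>)" by (rule sum_mono)
    ultimately show "real (qdist G (cut_label x) (cut_label y)) \<le>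
        (\<Sum>i\<in>cut_index. separates (min_cut (fst i)) x y)
        - (\<Sum>t\<in>T. \<Sum>k\<in>{2..petal_count t}. separates (L t k) x y)"
      using qdist_cut_label_add_excess_le[of x y] by linarith
  qed
  also have "\<dots> = (\<Sum>i\<in>cut_index. real (cut G (min_cut (fst i))))
      - (\<Sum>t\<in>T. \<Sum>k\<in>{2..petal_count t}. real (cut G (L t k)))"
    by (simp add: edge_total_diff edge_total_sum cut_eq_edge_total[OF wf])
  also have "(\<Sum>i\<in>cut_index. real (cut G (min_cut (fst i)))) = (\<Sum>i\<in>cut_index. real (lambda G (fst i)))"
    by (intro sum.cong refl) (simp add: min_cut(3)[OF cut_index_subset])
  also have "\<dots> = (\<Sum>A\<in>K. real (lambda G A)) + (\<Sum>t\<in>T. real (lambda G {t}))"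
    by (rule sum_cut_index)
  also have "(\<Sum>A\<in>K. real (lambda G A)) + (\<Sum>t\<in>T. real (lambda G {t}))
      - (\<Sum>t\<in>T. \<Sum>k\<in>{2..petal_count t}. real (cut G (L t k)))
      \<le> (\<Sum>A\<in>K. real (lambda G A)) + (\<Sum>t\<in>T. real (lambda G {t}))
      - (\<Sum>t\<in>T. (real (petal_count t) - 1) * real (lambda G {t}))"
  proof (intro diff_left_mono sum_mono)
    fix t assume t: "t \<in> T"
    have "(real (petal_count t) - 1) * real (lambda G {t}) = (\<Sum>k\<in>{2..petal_count t}. real (lambda G {t}))"
      using petal_count_pos[OF t] by (simp add: of_nat_diff)
    also have "\<dots> \<le> (\<Sum>k\<in>{2..petal_count t}. real (cut G (L t k)))"
      using L[OF t] by (intro sum_mono of_nat_mono) blast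
    finally show "(real (petal_count t) - 1) * real (lambda G {t}) \<le> (\<Sum>k\<in>{2..petal_count t}. real (cut G (L t k)))" .
  qed
  also have "\<dots> = 2 * (\<Sum>t\<in>T. real (lambda G {t}))
      - (\<Sum>t\<in>T. real (petal_count t) * real (lambda G {t})) + (\<Sum>A\<in>K. real (lambda G A))"
    by (simp add: left_diff_distrib sum_subtractf)
  also have "\<dots> \<le> 4 * cut_bound G"
  proof -
    have "(\<Sum>t\<in>T. real (lambda G {t})) \<le> (\<Sum>t\<in>T. real (cut G {t}))"
    proof (intro sum_mono of_nat_mono)
      fix t assume "t \<in> T"
      then show "lambda G {t} \<le> cut G {t}"
        using lambda_le_cut[OF wf, of "{t}"] T_subset_nodes by auto
    qed
    then show ?thesis by (simp add: cut_bound_expand)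
  qed
  finally show ?thesis by simp
qed

lemma theta_le_cut_bound: "theta G \<le> cut_bound G"
  using theta_le_cost[OF labelling_cut_label] cost_cut_label_le by linarith

end

section \<open>Lower bound from optimal labellings\<close>

context simple_K_network
begin

text \<open>The distances to \<open>At t\<close> cut \<open>Z\<close> into level sets around \<open>t\<close>, none of which has a smaller cut than \<open>Z\<close>.
  So the edges inside \<open>Z\<close> pay for the detours that the edges leaving \<open>Z\<close> make after relabelling.\<close>

lemma relabel_min_cut:
  assumes \<rho>: "labelling G \<rho>" and t: "t \<in> T"
    and Z: "Z \<subseteq> nodes G" "Z \<inter> T = {t}" "cut G Z = lambda G {t}"
  shows "labelling G (\<lambda>v. if v \<in> Z then At t else \<rho> v)"
    and "cost G (\<lambda>v. if v \<in> Z then At t else \<rho> v) \<le> cost G \<rho>"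
proof -
  let ?\<sigma> = "\<lambda>v. if v \<in> Z then At t else \<rho> v"
  show "labelling G ?\<sigma>"
    using \<rho> t Z(2) by (auto simp: labelling_def labels_def)
  define g where "g v = qdist G (At t) (\<rho> v)" for v
  define L where "L k = {v \<in> Z. g v \<le> k}" for k
  have g4: "g v \<le> 4" for v unfolding g_def by (cases "\<rho> v") auto
  have "edge_total G (\<lambda>x y. real (qdist G (?\<sigma> x) (?\<sigma> y)) +
      (\<Sum>k\<in>{..<4}. separates (L k) x y - separates Z x y)) \<le> edge_total G (\<lambda>x y. real (qdist G (\<rho> x) (\<rho> y)))"
  proof (rule edge_total_mono[OF wf])
    fix x y assume xy: "x \<in> nodes G" "y \<in> nodes G"
    have lab: "At t \<in> labels G" "\<rho> x \<in> labels G" "\<rho> y \<in> labels G"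
      using \<rho> t xy by (auto simp: labelling_def labels_def)
    have tri: "g y \<le> g x + qdist G (\<rho> x) (\<rho> y)" "g x \<le> g y + qdist G (\<rho> x) (\<rho> y)"
      using qdist_triangle[OF lab(1,2,3)] qdist_triangle[OF lab(1,3,2)]
      unfolding g_def by (simp_all add: qdist_sym[of G "\<rho> y" "\<rho> x"])
    have four: "{..<4 :: nat} = {0, 1, 2, 3}" by auto
    \<comment> \<open>Inside \<open>Z\<close> the levels add up to the difference of
      \<open>g\<close>. For an edge leaving \<open>Z\<close> from \<open>x\<close>, \<open>Z\<close>
      separates at all four levels but \<open>L k\<close> only from level \<open>g x\<close> on,
      which leaves \<open>- g x\<close>.\<close>
    have S: "(\<Sum>k\<in>{..<4}. separates (L k) x y - separates Z x y)
        = (if x \<in> Z then if y \<in> Z then \<bar>real (g x) - real (g y)\<bar> else - real (g x)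
           else if y \<in> Z then - real (g y) else 0)"
      using g4[of x] g4[of y] unfolding four by (auto simp: separates_def L_def abs_if)
    show "real (qdist G (?\<sigma> x) (?\<sigma> y)) + (\<Sum>k\<in>{..<4}. separates (L k) x y - separates Z x y)
        \<le> real (qdist G (\<rho> x) (\<rho> y))"
      unfolding S using tri by (auto simp: g_def[symmetric] qdist_sym[of G _ "At t"])
  qed
  moreover have "0 \<le> (\<Sum>k\<in>{..<4}. real (cut G (L k)) - real (cut G Z))"
  proof (intro sum_nonneg)
    fix k
    have "g t = 0" using \<rho> t by (simp add: g_def labelling_def)
    then have "L k \<inter> T = {t}" using Z(2) by (auto simp: L_def)
    moreover have "L k \<subseteq> nodes G" using Z(1) by (auto simp: L_def)
    ultimately show "0 \<le> real (cut G (L k)) - real (cut G Z)"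
      using lambda_le_cut[OF wf, of "L k"] Z(3) by simp
  qed
  moreover have "edge_total G (\<lambda>x y. real (qdist G (?\<sigma> x) (?\<sigma> y)) +
      (\<Sum>k\<in>{..<4}. separates (L k) x y - separates Z x y))
    = edge_total G (\<lambda>x y. real (qdist G (?\<sigma> x) (?\<sigma> y)))
      + (\<Sum>k\<in>{..<4}. real (cut G (L k)) - real (cut G Z))"
    by (simp add: edge_total_add edge_total_sum edge_total_diff cut_eq_edge_total[OF wf])
  ultimately show "cost G ?\<sigma> \<le> cost G \<rho>"
    unfolding cost_def edge_total_divide by linarith
qed

text \<open>The rank of a label equals \<open>h\<close> plus the number of sets \<open>Z A\<close>
  around the node: a terminal lies in \<open>petal_count\<close> of them, and \<open>h\<close>
  corrects this to 2. A second node labelled \<open>At t\<close> would lack the correction, hence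
  \<open>only\<close>. The hypothesis \<open>lam\<close> lets the negative terms be expressed by the
  cut of \<open>{t}\<close>.\<close>

lemma cut_bound_le_cost:
  assumes \<rho>: "labelling G \<rho>" and only: "\<And>t v. t \<in> T \<Longrightarrow> v \<in> nodes G \<Longrightarrow> \<rho> v = At t \<Longrightarrow> v = t"
    and lam: "\<And>t. t \<in> T \<Longrightarrow> lambda G {t} = cut G {t}"
  shows "cut_bound G \<le> cost G \<rho>"
proof -
  define Z where "Z A = {v \<in> nodes G. \<rho> v = Mid A \<or> \<rho> v \<in> At ` A}" for A
  have Z: "lambda G A \<le> cut G (Z A)" if "A \<in> K" for A
  proof -
    have "Z A \<inter> T = A"
      using \<rho> anticlique_subset[OF that] T_subset_nodes by (auto simp: Z_def labelling_def)
    then show ?thesis using lambda_le_cut[OF wf, of "Z A"] by (simp add: Z_def)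
  qed
  define h where "h v = (if v \<in> T then 2 - real (petal_count v) else 0)" for v
  have "4 * cut_bound G \<le> (\<Sum>t\<in>T. (2 - real (petal_count t)) * real (cut G {t})) + (\<Sum>A\<in>K. real (cut G (Z A)))"
  proof -
    have "(\<Sum>A\<in>K. real (lambda G A)) \<le> (\<Sum>A\<in>K. real (cut G (Z A)))"
      using Z by (intro sum_mono of_nat_mono) blast
    moreover have "(\<Sum>t\<in>T. real (petal_count t) * real (lambda G {t}))
        = (\<Sum>t\<in>T. real (petal_count t) * real (cut G {t}))"
      using lam by (intro sum.cong) auto
    ultimately show ?thesis
      unfolding cut_bound_expand by (simp add: left_diff_distrib sum_subtractf sum_distrib_left)
  qed
  also have "\<dots> = edge_total G (\<lambda>x y. (\<Sum>t\<in>T. (2 - real (petal_count t)) * separates {t} x y)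
      + (\<Sum>A\<in>K. separates (Z A) x y))"
    by (simp add: edge_total_add edge_total_sum edge_total_scale cut_eq_edge_total[OF wf])
  also have "\<dots> \<le> edge_total G (\<lambda>x y. real (qdist G (\<rho> x) (\<rho> y)))"
  proof (rule edge_total_mono[OF wf])
    fix x y assume xy: "x \<in> nodes G" "y \<in> nodes G"
    define N where "N v = {A \<in> K. v \<in> Z A}" for v
    have finN: "finite (N v)" for v using finite_K by (simp add: N_def)
    have N: "(\<Sum>A\<in>K. separates (Z A) x y)
        = real (card (N x)) + real (card (N y)) - 2 * real (card (N x \<inter> N y))"
      unfolding card_diff_add_card_diff[OF finN finN, symmetric]
      unfolding separates_def N_def by (rule sum_membership[OF finite_K])
    show "(\<Sum>t\<in>T. (2 - real (petal_count t)) * separates {t} x y) + (\<Sum>A\<in>K. separates (Z A) x y)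
        \<le> real (qdist G (\<rho> x) (\<rho> y))"
    proof (cases "x = y")
      case True
      then show ?thesis by (simp add: separates_def)
    next
      case False
      have "(\<Sum>t\<in>T. (2 - real (petal_count t)) * separates {t} x y)
          = (\<Sum>t\<in>T. (if t = x then h x else 0) + (if t = y then h y else 0))"
        using False by (intro sum.cong) (auto simp: separates_def h_def)
      also have "\<dots> = h x + h y"
        using finite_T by (simp add: sum.distrib h_def)
      finally have h: "(\<Sum>t\<in>T. (2 - real (petal_count t)) * separates {t} x y) = h x + h y" .
      have type: "(\<rho> v = At v \<and> v \<in> T \<and> h v + real (card (N v)) = 2 \<and> N v = {A \<in> K. v \<in> A}) \<or>
          (\<exists>A\<in>K. \<rho> v = Mid A \<and> h v + real (card (N v)) = 1 \<and> N v = {A}) \<or>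
          (\<rho> v = Centre \<and> h v + real (card (N v)) = 0 \<and> N v = {})" if v: "v \<in> nodes G" for v
      proof -
        have "\<rho> v \<in> labels G" using \<rho> v by (simp add: labelling_def)
        then consider t where "t \<in> T" "\<rho> v = At t" | A where "A \<in> K" "\<rho> v = Mid A" | "\<rho> v = Centre"
          by (auto simp: labels_def)
        then show ?thesis
        proof cases
          case 1
          then have "v = t" using only v by blast
          moreover from this have "N v = {A \<in> K. v \<in> A}" using 1 v by (auto simp: N_def Z_def)
          ultimately show ?thesis using 1 by (simp add: h_def)
        next
          case 2
          then have "v \<notin> T" "N v = {A}" using \<rho> v by (auto simp: N_def Z_def labelling_def)
          then show ?thesis using 2 by (simp add: h_def)
        next
          case 3
          then have "v \<notin> T" "N v = {}" using \<rho> v by (auto simp: N_def Z_def labelling_def)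
          then show ?thesis using 3 by (simp add: h_def)
        qed
      qed
      have inter: "real (card (N x \<inter> N y)) \<ge> 1" if "A \<in> N x" "A \<in> N y" for A
      proof -
        have "N x \<inter> N y \<noteq> {}" using that by blast
        then show ?thesis using finN[of x] by (simp add: Suc_le_eq card_gt_0_iff)
      qed
      have "h x + h y + real (card (N x)) + real (card (N y)) - 2 * real (card (N x \<inter> N y))
          \<le> real (qdist G (\<rho> x) (\<rho> y))"
        using type[OF xy(1)] type[OF xy(2)]
      proof (elim disjE conjE bexE)
        assume x: "\<rho> x = At x" "x \<in> T" "h x + real (card (N x)) = 2" "N x = {A \<in> K. x \<in> A}"
          and y: "\<rho> y = At y" "y \<in> T" "h y + real (card (N y)) = 2" "N y = {A \<in> K. y \<in> A}"
        show ?thesis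
        proof (cases "demand x y")
          case True
          then show ?thesis using x y False by simp
        next
          case nd: False
          obtain A where "A \<in> K" "x \<in> A" "y \<in> A" using anticlique_pair[OF x(2) y(2) nd] by blast
          then have "real (card (N x \<inter> N y)) \<ge> 1" using inter[of A] x(4) y(4) by blast
          moreover have "real (qdist G (\<rho> x) (\<rho> y)) = 2" using x(1) y(1) nd False by simp
          ultimately show ?thesis using x(3) y(3) by linarith
        qed
      next
        fix A assume x: "\<rho> x = At x" "h x + real (card (N x)) = 2" "N x = {A \<in> K. x \<in> A}"
          and y: "A \<in> K" "\<rho> y = Mid A" "h y + real (card (N y)) = 1" "N y = {A}"
        have "real (card (N x \<inter> N y)) \<ge> 1" if "x \<in> A" using inter[of A] x(3) y(1,4) that by blast
        then show ?thesis using x(1,2) y(2,3) by (cases "x \<in> A") auto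
      next
        fix A assume y: "\<rho> y = At y" "h y + real (card (N y)) = 2" "N y = {A \<in> K. y \<in> A}"
          and x: "A \<in> K" "\<rho> x = Mid A" "h x + real (card (N x)) = 1" "N x = {A}"
        have "real (card (N x \<inter> N y)) \<ge> 1" if "y \<in> A" using inter[of A] y(3) x(1,4) that by blast
        then show ?thesis using y(1,2) x(2,3) by (cases "y \<in> A") auto
      qed auto
      then show ?thesis unfolding h N by linarith
    qed
  qed
  also have "\<dots> = 4 * cost G \<rho>" by (simp add: cost_def edge_total_divide)
  finally show ?thesis by simp
qed

text \<open>Relabelling a minimum cut of \<open>{t}\<close> by \<open>At t\<close> keeps the
  labelling optimal. By hypothesis the cut then consists of \<open>t\<close> alone, so
  \<open>{t}\<close> is itself a minimum cut.\<close>

lemma cut_bound_le_theta: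
  assumes "\<And>\<rho> t v. labelling G \<rho> \<Longrightarrow> cost G \<rho> = theta G \<Longrightarrow> t \<in> T \<Longrightarrow> v \<in> nodes G \<Longrightarrow> \<rho> v = At t \<Longrightarrow> v = t"
  shows "cut_bound G \<le> theta G"
proof -
  obtain \<rho> where \<rho>: "labelling G \<rho>" "cost G \<rho> = theta G" using theta_labelling by blast
  have "lambda G {t} = cut G {t}" if t: "t \<in> T" for t
  proof -
    obtain Z where Z: "Z \<subseteq> nodes G" "Z \<inter> T = {t}" "cut G Z = lambda G {t}"
      using lambda_attained[OF wf, of "{t}"] t by auto
    let ?\<sigma> = "\<lambda>v. if v \<in> Z then At t else \<rho> v"
    have "cost G ?\<sigma> = theta G"
      using relabel_min_cut[OF \<rho>(1) t Z] theta_le_cost[of ?\<sigma>] \<rho>(2) by simp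
    then have "v = t" if "v \<in> Z" for v
      using assms[OF relabel_min_cut(1)[OF \<rho>(1) t Z], of t v] t that Z(1) by auto
    then have "Z = {t}" using Z(2) by blast
    then show ?thesis using Z(3) by simp
  qed
  then show ?thesis using cut_bound_le_cost[OF \<rho>(1)] assms[OF \<rho>] \<rho>(2) by simp
qed

end

section \<open>Contraction and critical expansions\<close>

lemma contract_simps [simp]:
  "nodes (contract G X) = contraction_map G X ` nodes G" "edges (contract G X) = edges G"
  "ends (contract G X) e = contraction_map G X ` ends G e"
  "terminals (contract G X) = terminals G" "demands (contract G X) = demands G"
  by (simp_all add: contract_def)

lemma anticliques_contract [simp]: "anticliques (contract G X) = anticliques G"
  by (simp add: anticliques_def stable_def)

lemma labels_contract [simp]: "labels (contract G X) = labels G"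
  by (simp add: labels_def)

lemma qdist_contract [simp]: "qdist (contract G X) a b = qdist G a b"
  by (cases a; cases b) simp_all

lemma contraction_map_in:
  assumes "expansion G X" "t \<in> terminals G" "v \<in> X t"
  shows "contraction_map G X v = t"
proof -
  have "s = t" if "s \<in> terminals G" "v \<in> X s" for s
    using assms that unfolding expansion_def disjoint_family_on_def by blast
  then have the: "(THE s. s \<in> terminals G \<and> v \<in> X s) = t"
    by (intro the_equality) (use assms in blast)+
  have "\<exists>s\<in>terminals G. v \<in> X s" using assms by blast
  then show ?thesis by (simp add: contraction_map_def the)
qed

lemma contraction_map_out:
  "(\<And>t. t \<in> terminals G \<Longrightarrow> v \<notin> X t) \<Longrightarrow> contraction_map G X v = v"
  by (auto simp: contraction_map_def)

lemma expansion_self: "expansion G X \<Longrightarrow> t \<in> terminals G \<Longrightarrow> t \<in> X t"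
  by (auto simp: expansion_def)

lemma contraction_map_terminal:
  "expansion G X \<Longrightarrow> t \<in> terminals G \<Longrightarrow> contraction_map G X t = t"
  by (rule contraction_map_in) (auto intro: expansion_self)

lemma contraction_map_eq_terminal_iff:
  assumes "expansion G X" "t \<in> terminals G"
  shows "contraction_map G X v = t \<longleftrightarrow> v \<in> X t"
proof
  assume eq: "contraction_map G X v = t"
  show "v \<in> X t"
  proof (cases "\<exists>s\<in>terminals G. v \<in> X s")
    case True
    then show ?thesis using contraction_map_in[OF assms(1)] eq by blast
  next
    case False
    then have "contraction_map G X v = v" by (intro contraction_map_out) blast
    then show ?thesis using eq expansion_self[OF assms] by simp
  qed
qed (rule contraction_map_in[OF assms])

lemma wf_network_contract:
  assumes "wf_network G" "expansion G X"
  shows "wf_network (contract G X)"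
proof -
  have "card (contraction_map G X ` ends G e) \<in> {1, 2}" if e: "e \<in> edges G" for e
  proof -
    obtain x y where "ends G e = {x, y}" using wf_network_ends[OF assms(1) e] by metis
    then show ?thesis by (cases "contraction_map G X x = contraction_map G X y") auto
  qed
  moreover have "terminals G \<subseteq> contraction_map G X ` nodes G"
  proof
    fix t assume t: "t \<in> terminals G"
    then have "t = contraction_map G X t" "t \<in> nodes G"
      using contraction_map_terminal[OF assms(2)] assms(1) by (auto simp: wf_network_def)
    then show "t \<in> contraction_map G X ` nodes G" by (rule image_eqI)
  qed
  moreover have "contraction_map G X ` ends G e \<subseteq> contraction_map G X ` nodes G" if "e \<in> edges G" for e
    using that assms(1) by (intro image_mono) (simp add: wf_network_def)
  ultimately show ?thesis using assms(1) by (simp add: wf_network_def)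
qed

text \<open>An edge whose ends are merged becomes a loop; both sides count it as 0 because
  \<open>d\<close> vanishes on the diagonal.\<close>

lemma edge_total_contract:
  assumes "wf_network G" "\<And>x. d x x = 0" "\<And>x y. d x y = d y x"
  shows "edge_total (contract G X) d
    = edge_total G (\<lambda>x y. d (contraction_map G X x) (contraction_map G X y))"
  unfolding edge_total_def contract_simps
proof (intro sum.cong refl)
  fix e assume "e \<in> edges G"
  from wf_network_ends[OF assms(1) this] obtain x y where e: "ends G e = {x, y}" by metis
  let ?k = "contraction_map G X"
  have "(\<Sum>a\<in>{?k x, ?k y}. \<Sum>b\<in>{?k x, ?k y}. d a b) / 2 = d (?k x) (?k y)"
    by (rule edge_sum_pair) (use assms in auto)
  moreover have "(\<Sum>a\<in>{x, y}. \<Sum>b\<in>{x, y}. d (?k a) (?k b)) / 2 = d (?k x) (?k y)"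
    by (rule edge_sum_pair) (use assms in auto)
  ultimately show "(\<Sum>a\<in>?k ` ends G e. \<Sum>b\<in>?k ` ends G e. d a b) / 2
      = (\<Sum>a\<in>ends G e. \<Sum>b\<in>ends G e. d (?k a) (?k b)) / 2"
    unfolding e by simp
qed

lemma cost_contract:
  assumes "wf_network G"
  shows "cost (contract G X) \<rho> = cost G (\<lambda>v. \<rho> (contraction_map G X v))"
  unfolding cost_def qdist_contract
  by (rule edge_total_contract[OF assms]) (simp_all add: qdist_sym)

lemma labelling_contract:
  assumes "expansion G X" "labelling (contract G X) \<rho>"
  shows "labelling G (\<lambda>v. \<rho> (contraction_map G X v))"
  using assms contraction_map_terminal[OF assms(1)] by (simp add: labelling_def)

lemma cut_contract_terminal:
  assumes "wf_network G" "expansion G X" "t \<in> terminals G"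
  shows "cut (contract G X) {t} = cut G (X t)"
proof -
  have "real (cut (contract G X) {t}) = edge_total (contract G X) (separates {t})"
    by (rule cut_eq_edge_total[OF wf_network_contract[OF assms(1,2)]])
  also have "\<dots> = edge_total G (\<lambda>x y. separates {t} (contraction_map G X x) (contraction_map G X y))"
    by (rule edge_total_contract[OF assms(1)]) (auto simp: separates_def)
  also have "\<dots> = real (cut G (X t))"
    unfolding cut_eq_edge_total[OF assms(1)]
    by (rule edge_total_cong[OF assms(1)])
      (simp add: separates_def contraction_map_eq_terminal_iff[OF assms(2,3)])
  finally show ?thesis by simp
qed

lemma dual_value_eq_cut_bound:
  assumes "wf_network G" "expansion G X"
  shows "dual_value G X = cut_bound (contract G X)"
  using cut_contract_terminal[OF assms] by (simp add: dual_value_def cut_bound_def)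

context simple_K_network
begin

lemma simple_K_network_contract:
  assumes "expansion G X" shows "simple_K_network (contract G X)"
proof
  show "wf_network (contract G X)" by (rule wf_network_contract[OF wf assms])
  show "simple_anticliques (contract G X)" using simple by (simp add: simple_anticliques_def)
  show "A \<inter> B = A \<inter> C"
    if "A \<in> anticliques (contract G X)" "B \<in> anticliques (contract G X)" "C \<in> anticliques (contract G X)"
      "A \<noteq> B" "A \<noteq> C" "B \<noteq> C" "A \<inter> B \<noteq> {}" "A \<inter> C \<noteq> {}" "B \<inter> C \<noteq> {}" for A B C
    using flower[of A B C] that by simp
qed

lemma theta_le_theta_contract:
  assumes X: "expansion G X" shows "theta G \<le> theta (contract G X)"
proof -
  interpret C: simple_K_network "contract G X" by (rule simple_K_network_contract[OF X])
  obtain \<rho> where "labelling (contract G X) \<rho>" "cost (contract G X) \<rho> = theta (contract G X)"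
    using C.theta_labelling by blast
  then show ?thesis
    using theta_le_cost[OF labelling_contract[OF X]] cost_contract[OF wf] by metis
qed

lemma theta_le_dual_value:
  assumes X: "expansion G X" shows "theta G \<le> dual_value G X"
proof -
  interpret C: simple_K_network "contract G X" by (rule simple_K_network_contract[OF X])
  show ?thesis
    using theta_le_theta_contract[OF X] C.theta_le_cut_bound dual_value_eq_cut_bound[OF wf X] by simp
qed

text \<open>An optimal labelling of the contracted network is also a labelling of the network in which the
  nodes labelled by terminals have been contracted further, so a critical expansion leaves no
  node to contract.\<close>

lemma critical_optimal_labelling:
  assumes crit: "critical G X" and \<rho>: "labelling (contract G X) \<rho>"
    and opt: "cost (contract G X) \<rho> = theta (contract G X)"
    and t: "t \<in> T" and v: "v \<in> nodes (contract G X)" "\<rho> v = At t"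
  shows "v = t"
proof -
  have X: "expansion G X" using crit by (simp add: critical_def)
  define \<sigma> where "\<sigma> v = \<rho> (contraction_map G X v)" for v
  have \<sigma>: "labelling G \<sigma>" unfolding \<sigma>_def by (rule labelling_contract[OF X \<rho>])
  define Y where "Y s = {v \<in> nodes G. \<sigma> v = At s}" for s
  have Y: "expansion G Y"
    using \<sigma> T_subset_nodes by (auto simp: expansion_def Y_def labelling_def disjoint_family_on_def)
  have le: "expansion_le G X Y"
    unfolding expansion_le_def
  proof (intro ballI subsetI)
    fix s x assume s: "s \<in> T" and x: "x \<in> X s"
    have "\<sigma> x = At s"
      using contraction_map_in[OF X s x] \<rho> s by (simp add: \<sigma>_def labelling_def)
    then show "x \<in> Y s" using X s x by (auto simp: Y_def expansion_def)
  qed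
  \<comment> \<open>A node in \<open>Y s\<close> is renamed \<open>s\<close> and keeps the label
    \<open>At s\<close>. All other nodes are fixed by both contractions.\<close>
  have eq: "\<rho> (contraction_map G Y x) = \<sigma> x" if x: "x \<in> nodes G" for x
  proof (cases "\<exists>s\<in>T. x \<in> Y s")
    case True
    then obtain s where s: "s \<in> T" "x \<in> Y s" by blast
    have "\<sigma> x = At s" using s(2) by (simp add: Y_def)
    then show ?thesis using contraction_map_in[OF Y s] \<rho> s(1) by (simp add: labelling_def)
  next
    case False
    then have "contraction_map G Y x = x" "contraction_map G X x = x"
      using le by (auto intro!: contraction_map_out simp: expansion_le_def)
    then show ?thesis by (simp add: \<sigma>_def)
  qed
  interpret CY: simple_K_network "contract G Y" by (rule simple_K_network_contract[OF Y])
  have "labelling (contract G Y) \<rho>"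
    using \<sigma> \<rho> eq by (auto simp: labelling_def)
  then have "theta (contract G Y) \<le> cost (contract G Y) \<rho>" by (rule CY.theta_le_cost)
  also have "\<dots> = cost G (\<lambda>v. \<rho> (contraction_map G Y v))" by (rule cost_contract[OF wf])
  also have "\<dots> = cost G \<sigma>"
    unfolding cost_def by (rule edge_total_cong[OF wf]) (simp add: eq)
  also have "\<dots> = theta (contract G X)"
    using opt unfolding cost_contract[OF wf] \<sigma>_def by simp
  finally have "Y t = X t" using crit Y le t unfolding critical_def by force
  moreover obtain x where x: "x \<in> nodes G" "v = contraction_map G X x" using v(1) by auto
  moreover have "x \<in> Y t" using x v(2) by (simp add: Y_def \<sigma>_def)
  ultimately show ?thesis using contraction_map_in[OF X t] by blast
qed

lemma dual_value_dual_solution: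
  assumes "dual_solution G X" shows "dual_value G X = theta G"
proof -
  have crit: "critical G X" and eq: "theta (contract G X) = theta G" and X: "expansion G X"
    using assms unfolding dual_solution_def critical_def by blast+
  interpret C: simple_K_network "contract G X" by (rule simple_K_network_contract[OF X])
  have "cut_bound (contract G X) \<le> theta (contract G X)"
  proof (rule C.cut_bound_le_theta)
    fix \<rho> t v
    assume "labelling (contract G X) \<rho>" "cost (contract G X) \<rho> = theta (contract G X)"
      "t \<in> terminals (contract G X)" "v \<in> nodes (contract G X)" "\<rho> v = At t"
    then show "v = t" using critical_optimal_labelling[OF crit, of \<rho> t v] by simp
  qed
  then show ?thesis
    using theta_le_dual_value[OF X] dual_value_eq_cut_bound[OF wf X] eq by simp
qed

lemma contract_singletons: "contract G (\<lambda>t. {t}) = G"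
proof -
  have "contraction_map G (\<lambda>t. {t}) = (\<lambda>v. v)"
    by (auto simp: contraction_map_def fun_eq_iff intro!: the_equality)
  then show ?thesis by (simp add: contract_def)
qed

text \<open>Among the expansions that keep \<open>theta\<close> take one of largest total size. As
  contraction never lowers \<open>theta\<close>, every properly larger expansion raises it.\<close>

lemma dual_solution_exists: "\<exists>X. dual_solution G X"
proof -
  let ?P = "\<lambda>X. expansion G X \<and> theta (contract G X) = theta G"
  let ?m = "\<lambda>X. \<Sum>t\<in>T. card (X t)"
  have bound: "?m X < Suc (\<Sum>t\<in>T. card (nodes G))" if "?P X" for X
    unfolding less_Suc_eq_le using that by (intro sum_mono card_mono finite_nodes) (auto simp: expansion_def)
  have triv: "?P (\<lambda>t. {t})"
    using T_subset_nodes by (auto simp: contract_singletons expansion_def disjoint_family_on_def)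
  obtain X where X: "?P X" and max: "\<And>Y. ?P Y \<Longrightarrow> ?m Y \<le> ?m X"
    using ex_has_greatest_nat[of ?P, OF triv, of ?m] bound by blast
  have "theta (contract G X) < theta (contract G Y)"
    if Y: "expansion G Y" "expansion_le G X Y" "\<exists>t\<in>T. Y t \<noteq> X t" for Y
  proof -
    have fin: "finite (Y t)" if "t \<in> T" for t
      using Y(1) that finite_nodes finite_subset by (auto simp: expansion_def)
    have "?m X < ?m Y"
    proof (rule sum_strict_mono_ex1[OF finite_T])
      show "\<forall>t\<in>T. card (X t) \<le> card (Y t)"
        using Y(2) fin by (auto simp: expansion_le_def intro: card_mono)
      show "\<exists>t\<in>T. card (X t) < card (Y t)"
        using Y(2,3) fin psubset_card_mono unfolding expansion_le_def by (metis psubsetI)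
    qed
    then have "theta (contract G Y) \<noteq> theta G" using max[of Y] Y(1) by force
    then show ?thesis using theta_le_theta_contract[OF Y(1)] X by simp
  qed
  then have "dual_solution G X" using X unfolding dual_solution_def critical_def by blast
  then show ?thesis by blast
qed

end

theorem theorem3:
  fixes G :: "('v, 'e) network"
  assumes "K_network G" and "simple_anticliques G"
  shows "\<exists>m.
      (\<exists>f. multiflow G f \<and> Theta G f = m) \<and> (\<forall>f. multiflow G f \<longrightarrow> Theta G f \<le> m) \<and>
      (\<exists>X. expansion G X \<and> dual_value G X = m) \<and> (\<forall>X. expansion G X \<longrightarrow> m \<le> dual_value G X) \<and>
      (\<forall>X. dual_solution G X \<longrightarrow> dual_value G X = m)"
proof -
  interpret simple_K_network G
  proof
    fix A B C
    assume "A \<in> anticliques G" "B \<in> anticliques G" "C \<in> anticliques G" "A \<noteq> B" "A \<noteq> C" "B \<noteq> C"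
      "A \<inter> B \<noteq> {}" "A \<inter> C \<noteq> {}" "B \<inter> C \<noteq> {}"
    then show "A \<inter> B = A \<inter> C" using assms(1) unfolding K_network_def by blast
  qed (use assms in \<open>auto simp: K_network_def\<close>)
  obtain X where X: "dual_solution G X" using dual_solution_exists by blast
  then have "expansion G X" by (simp add: dual_solution_def critical_def)
  then show ?thesis
    using theta_attained Theta_le_theta theta_le_dual_value dual_value_dual_solution X
    by (intro exI[of _ "theta G"]) blast
qed

end
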